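(* Let $(X,\mu)$ be a standard probability space and $\mathcal R\subset X\times X$ a discrete Borel equivalence relation such that $\mu$ is $\mathcal R$-invariant and $\mathcal R$-ergodic. If $\mathcal R$ has rank 1, then for every aperiodic hyperfinite subequivalence relation $\mathcal S\le\mathcal R$, the subequivalence relation $\langle\mathcal S,N^q_{\mathcal R}(\mathcal S)\rangle$ generated by $\mathcal S$ and its quasi-normalizer $N^q_{\mathcal R}(\mathcal S)$ in $\mathcal R$ is hyperfinite.
   Context: A Borel equivalence relation $\mathcal R\subset X\times X$ is discrete if every class $[x]_{\mathcal R}$ is countable. $\mu$ is $\mathcal R$-invariant if $\phi_*\mu=\mu$ for every Borel isomorphism $\phi:X\to X$ with graph contained in $\mathcal R$; then $\mathcal R$ carries the measure $\hat\mu(F)=\int|\{y:(x,y)\in F\}|\,d\mu(x)$. $\mu$ is $\mathcal R$-ergodic if every Borel union $Y$ of $\mathcal R$-classes has $\mu(Y)\in\{0,1\}$. The full group $[\mathcal R]$ is the group of Borel isomorphisms $X\to X$ with graph in $\mathcal R$, modulo a.e. equality. A subequivalence relation $\mathcal S\le\mathcal R$ is a Borel subset of $\mathcal R$ that is an equivalence relation on $X$; it is aperiodic if a.e. class is infinite; it is hyperfinite if there are Borel subequivalence relations $\mathcal S_1\le\mathcal S_2\le\cdots$ with all $\mathcal S_n$-classes finite and $\mathcal S=\bigcup_n\mathcal S_n$. All notions are understood up to null sets (subequivalence relations with $\hat\mu$-null symmetric difference are identified). A hyperfinite $\mathcal S\le\mathcal R$ is maximal hyperfinite if there is no hyperfinite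 $\mathcal S'\le\mathcal R$ with $\mathcal S\le\mathcal S'$ and $\hat\mu(\mathcal S'\setminus\mathcal S)>0$. $\mathcal R$ has rank 1 if every aperiodic hyperfinite subequivalence relation of $\mathcal R$ is contained in a unique (up to null sets) maximal hyperfinite subequivalence relation. For $\phi\in[\mathcal R]$ put $\phi_*\mathcal S=\{(\phi(x),\phi(y)):(x,y)\in\mathcal S\}$. The quasi-normalizer $N^q_{\mathcal R}(\mathcal S)\le[\mathcal R]$ is the subgroup generated by all $\phi\in[\mathcal R]$ such that $\phi_*\mathcal S\cap\mathcal S$ is aperiodic. For $G\subset[\mathcal R]$, $\langle\mathcal S,G\rangle$ is the smallest (up to null sets) subequivalence relation containing $\mathcal S$ and, for each $g\in G$, the graph $\{(x,gx):x\in X\}$ up to null sets. *)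

theory Defs
  imports
    "HOL-Analysis.Analysis"
    "HOL-Probability.Probability_Measure"
    "HOL-Algebra.Bij"
    "HOL-Algebra.Coset"
    "HOL-Algebra.Generated_Groups"
begin

definition standard_borel :: "'a measure \<Rightarrow> bool" where
  "standard_borel M \<longleftrightarrow>
     (\<exists>T. topspace T = space M \<and> completely_metrizable_space T \<and> separable_space T \<and>
          sets M = sigma_sets (space M) {U. openin T U})"

definition standard_prob_space :: "'a measure \<Rightarrow> bool" where
  "standard_prob_space M \<longleftrightarrow> prob_space M \<and> standard_borel M"

definition borel_equiv :: "'a measure \<Rightarrow> ('a \<times> 'a) set \<Rightarrow> bool" where
  "borel_equiv M R \<longleftrightarrow> R \<in> sets (M \<Otimes>\<^sub>M M) \<and> equiv (space M) R"

definition discrete_borel_equiv :: "'a measure \<Rightarrow> ('a \<times> 'a) set \<Rightarrow> bool" where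
  "discrete_borel_equiv M R \<longleftrightarrow> borel_equiv M R \<and> (\<forall>x\<in>space M. countable (R `` {x}))"

text \<open>
  The group of Borel isomorphisms of the space whose graph is contained in \<open>R\<close>, before
  identification modulo null sets. As in \<^const>\<open>BijGroup\<close>, maps are extensional outside
  the space.
\<close>

definition borel_full_group :: "'a measure \<Rightarrow> ('a \<times> 'a) set \<Rightarrow> ('a \<Rightarrow> 'a) monoid" where
  "borel_full_group M R = (BijGroup (space M))
     \<lparr>carrier := {\<phi> \<in> Bij (space M).
        \<phi> \<in> measurable M M \<and> inv_into (space M) \<phi> \<in> measurable M M \<and>
        (\<forall>x\<in>space M. (x, \<phi> x) \<in> R)}\<rparr>"

definition invariant_measure :: "'a measure \<Rightarrow> ('a \<times> 'a) set \<Rightarrow> bool" where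
  "invariant_measure M R \<longleftrightarrow>
     (\<forall>\<phi>\<in>carrier (borel_full_group M R). distr M M \<phi> = M)"

definition ergodic_measure :: "'a measure \<Rightarrow> ('a \<times> 'a) set \<Rightarrow> bool" where
  "ergodic_measure M R \<longleftrightarrow>
     (\<forall>Y\<in>sets M. R `` Y = Y \<longrightarrow> emeasure M Y = 0 \<or> emeasure M Y = 1)"

text \<open>
  The full group: the quotient by the normal subgroup of those maps that are almost everywhere
  the identity. Its elements are cosets, that is, classes of maps modulo almost everywhere
  equality.
\<close>

definition full_group :: "'a measure \<Rightarrow> ('a \<times> 'a) set \<Rightarrow> ('a \<Rightarrow> 'a) set monoid" where
  "full_group M R = borel_full_group M R Mod
     {\<phi> \<in> carrier (borel_full_group M R). AE x in M. \<phi> x = x}"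

text \<open>
  The measure induced by \<open>M\<close> on \<open>R\<close>; it is only applied to Borel subsets of a discrete Borel equivalence
  relation, for which the integrand is measurable.
\<close>

definition rel_measure :: "'a measure \<Rightarrow> ('a \<times> 'a) set \<Rightarrow> ennreal" where
  "rel_measure M F = (\<integral>\<^sup>+x. emeasure (count_space UNIV) {y. (x, y) \<in> F} \<partial>M)"

definition ae_subset :: "'a measure \<Rightarrow> ('a \<times> 'a) set \<Rightarrow> ('a \<times> 'a) set \<Rightarrow> bool" where
  "ae_subset M A B \<longleftrightarrow> rel_measure M (A - B) = 0"

definition ae_eq :: "'a measure \<Rightarrow> ('a \<times> 'a) set \<Rightarrow> ('a \<times> 'a) set \<Rightarrow> bool" where
  "ae_eq M A B \<longleftrightarrow> rel_measure M ((A - B) \<union> (B - A)) = 0"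

definition subequiv :: "'a measure \<Rightarrow> ('a \<times> 'a) set \<Rightarrow> ('a \<times> 'a) set \<Rightarrow> bool" where
  "subequiv M R S \<longleftrightarrow> borel_equiv M S \<and> S \<subseteq> R"

definition aperiodic :: "'a measure \<Rightarrow> ('a \<times> 'a) set \<Rightarrow> bool" where
  "aperiodic M S \<longleftrightarrow> (AE x in M. infinite (S `` {x}))"

definition hyperfinite :: "'a measure \<Rightarrow> ('a \<times> 'a) set \<Rightarrow> bool" where
  "hyperfinite M S \<longleftrightarrow>
     (\<exists>F :: nat \<Rightarrow> ('a \<times> 'a) set.
        (\<forall>n. subequiv M S (F n) \<and> (\<forall>x\<in>space M. finite (F n `` {x}))) \<and>
        (\<forall>n. F n \<subseteq> F (Suc n)) \<and>
        ae_eq M S (\<Union>n. F n))"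

definition maximal_hyperfinite :: "'a measure \<Rightarrow> ('a \<times> 'a) set \<Rightarrow> ('a \<times> 'a) set \<Rightarrow> bool" where
  "maximal_hyperfinite M R S \<longleftrightarrow>
     subequiv M R S \<and> hyperfinite M S \<and>
     \<not> (\<exists>S'. subequiv M R S' \<and> hyperfinite M S' \<and> ae_subset M S S' \<and>
            rel_measure M (S' - S) > 0)"

definition rank_one :: "'a measure \<Rightarrow> ('a \<times> 'a) set \<Rightarrow> bool" where
  "rank_one M R \<longleftrightarrow>
     (\<forall>S. subequiv M R S \<and> aperiodic M S \<and> hyperfinite M S \<longrightarrow>
        (\<exists>T. maximal_hyperfinite M R T \<and> ae_subset M S T \<and>
             (\<forall>T'. maximal_hyperfinite M R T' \<and> ae_subset M S T' \<longrightarrow> ae_eq M T' T)))"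

definition push_rel :: "('a \<Rightarrow> 'a) \<Rightarrow> ('a \<times> 'a) set \<Rightarrow> ('a \<times> 'a) set" where
  "push_rel \<phi> S = {(\<phi> x, \<phi> y) | x y. (x, y) \<in> S}"

definition quasi_normalizer ::
    "'a measure \<Rightarrow> ('a \<times> 'a) set \<Rightarrow> ('a \<times> 'a) set \<Rightarrow> ('a \<Rightarrow> 'a) set set" where
  "quasi_normalizer M R S = generate (full_group M R)
     {c \<in> carrier (full_group M R). \<exists>\<phi>\<in>c. aperiodic M (push_rel \<phi> S \<inter> S)}"

text \<open>
  \<open>Q\<close> is (a representative of) the subequivalence relation of \<open>R\<close> generated by \<open>S\<close> and the set
  \<open>G\<close> of elements of the full group. It is determined only up to null sets, hence a predicate.
\<close>

definition contains_rel_and_graphs ::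
    "'a measure \<Rightarrow> ('a \<times> 'a) set \<Rightarrow> ('a \<Rightarrow> 'a) set set \<Rightarrow> ('a \<times> 'a) set \<Rightarrow> bool" where
  "contains_rel_and_graphs M S G Q \<longleftrightarrow>
     ae_subset M S Q \<and> (\<forall>c\<in>G. \<forall>\<phi>\<in>c. ae_subset M {(x, \<phi> x) | x. x \<in> space M} Q)"

definition is_generated_subequiv ::
    "'a measure \<Rightarrow> ('a \<times> 'a) set \<Rightarrow> ('a \<times> 'a) set \<Rightarrow> ('a \<Rightarrow> 'a) set set \<Rightarrow> ('a \<times> 'a) set \<Rightarrow> bool" where
  "is_generated_subequiv M R S G Q \<longleftrightarrow>
     subequiv M R Q \<and> contains_rel_and_graphs M S G Q \<and>
     (\<forall>Q'. subequiv M R Q' \<and> contains_rel_and_graphs M S G Q' \<longrightarrow> ae_subset M Q Q')"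

end

theory Submission
  imports Defs
begin

text \<open>
  Let \<open>Tm\<close> be the maximal hyperfinite subequivalence relation that contains \<open>S\<close>. The maps whose graph
  lies in \<open>Tm\<close> up to null sets form a subgroup of the full group. Hence it is enough that every
  quasi-normalizing map \<open>\<phi>\<close> has its graph in \<open>Tm\<close>: then so has every map in the quasi-normalizer, the
  relation generated by \<open>S\<close> and the quasi-normalizer lies in \<open>Tm\<close>, and a subrelation of a hyperfinite
  relation is hyperfinite. All inclusions here are up to null sets.

  Rank 1 enters as follows (\<open>rank_one_absorb\<close>). Let \<open>B\<close> be an aperiodic hyperfinite relation inside
  \<open>Tm\<close>. Every hyperfinite relation that contains \<open>B\<close> lies in \<open>Tm\<close>, since only one maximal hyperfinite
  relation contains \<open>B\<close>. Now let \<open>A\<close> be disjoint from \<open>\<phi>(A)\<close>, and let \<open>E\<close> be the part of \<open>S\<close> that \<open>\<phi>\<close>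
  maps into \<open>S\<close>, which is aperiodic as \<open>\<phi>\<close> quasi-normalizes \<open>S\<close>. Fold \<open>\<phi>(A)\<close> onto \<open>A\<close> by the inverse of
  \<open>\<phi>\<close>, and pull \<open>E\<close> back along this map. The resulting relation is hyperfinite because the folding is at
  most two-to-one; it relates \<open>x\<close> to \<open>\<phi> x\<close> for \<open>x \<in> A\<close>; and its intersection with \<open>S\<close> is aperiodic by
  Poincare recurrence. So it lies in \<open>Tm\<close> (\<open>quasi_normalizing_on_displaced_set\<close>). Countably many sets
  \<open>A\<close> cover all points moved by \<open>\<phi>\<close>.

  The remaining work is measure theory. Sets such as \<open>{x. \<exists>y. (x, y) \<in> F}\<close> are projections of Borel
  sets. They are measurable for the completed measure, by Choquet's capacitability theorem: the outer
  measure of the projection of \<open>F\<close> is approximated by the projections of compact subsets of \<open>F\<close>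
  (\<open>compact_projection_approx\<close>). These compact sets also give access to the invariance of the measure.
  A compact partial isomorphism between disjoint sets extends to a Borel involution, so partial
  isomorphisms preserve the measure. Recurrence follows, because in an aperiodic hyperfinite relation
  a Borel set that meets each class at most once is null: its points would have pairwise disjoint
  infinite classes in a probability space (\<open>transversal_null\<close>).

  Finally, a smallest relation among those that contain \<open>S\<close> and uncountably many graphs has to be
  found. Inside the hyperfinite relation \<open>Tm\<close> a relation is determined up to null sets by countably
  many measurable sets, whose measures can be minimized (\<open>ex_generated_subequiv\<close>).
\<close>

section \<open>Analytic sets in Polish spaces\<close>

lemma open_baire_iff:
  fixes U :: "(nat \<Rightarrow> nat) set"
  shows "open U \<longleftrightarrow> (\<forall>\<sigma>\<in>U. \<exists>n. \<forall>\<tau>. (\<forall>i<n. \<tau> i = \<sigma> i) \<longrightarrow> \<tau> \<in> U)"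
proof
  assume U: "open U"
  show "\<forall>\<sigma>\<in>U. \<exists>n. \<forall>\<tau>. (\<forall>i<n. \<tau> i = \<sigma> i) \<longrightarrow> \<tau> \<in> U"
  proof
    fix \<sigma> assume "\<sigma> \<in> U"
    then obtain X where X: "\<sigma> \<in> Pi\<^sub>E UNIV X" "finite {i. X i \<noteq> UNIV}" "Pi\<^sub>E UNIV X \<subseteq> U"
      using product_topology_open_contains_basis[of "\<lambda>i::nat. euclidean :: nat topology" UNIV U \<sigma>] U
      by (auto simp: open_fun_def)
    obtain n where n: "\<And>i. X i \<noteq> UNIV \<Longrightarrow> i < n"
      using X(2) unfolding finite_nat_set_iff_bounded by auto
    have "\<tau> \<in> U" if "\<forall>i<n. \<tau> i = \<sigma> i" for \<tau>
    proof -
      have "\<tau> i \<in> X i" for i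
        using X(1) n[of i] that by (cases "X i = UNIV") (auto simp: PiE_iff)
      then show ?thesis using X(3) by (auto simp: PiE_iff)
    qed
    then show "\<exists>n. \<forall>\<tau>. (\<forall>i<n. \<tau> i = \<sigma> i) \<longrightarrow> \<tau> \<in> U" by blast
  qed
next
  assume R: "\<forall>\<sigma>\<in>U. \<exists>n. \<forall>\<tau>. (\<forall>i<n. \<tau> i = \<sigma> i) \<longrightarrow> \<tau> \<in> U"
  show "open U"
  proof (rule topological_space_class.openI)
    fix \<sigma> assume "\<sigma> \<in> U"
    then obtain n where n: "\<forall>\<tau>. (\<forall>i<n. \<tau> i = \<sigma> i) \<longrightarrow> \<tau> \<in> U" using R by blast
    have "open {\<tau>::nat \<Rightarrow> nat. \<forall>i\<in>{..<n}. \<tau> i \<in> {\<sigma> i}}"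
      by (rule product_topology_basis') (auto simp: open_discrete)
    with n show "\<exists>W. open W \<and> \<sigma> \<in> W \<and> W \<subseteq> U"
      by (intro exI[of _ "{\<tau>. \<forall>i\<in>{..<n}. \<tau> i \<in> {\<sigma> i}}"]) auto
  qed
qed

lemma compact_baire_bounded: "compact {\<sigma>::nat \<Rightarrow> nat. \<forall>i. \<sigma> i \<le> b i}"
proof -
  have "compactin (product_topology (\<lambda>i::nat. euclidean :: nat topology) UNIV) (PiE UNIV (\<lambda>i. {..b i}))"
    by (subst compactin_PiE) (auto intro: finite_imp_compact)
  moreover have "PiE UNIV (\<lambda>i. {..b i}) = {\<sigma>. \<forall>i. \<sigma> i \<le> b i}"
    by (auto simp: PiE_iff)
  ultimately show ?thesis by (simp add: euclidean_product_topology)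
qed

text \<open>Taking continuous images of closed subsets of Baire space, instead of the whole of it, gives the
  same nonempty sets, and makes the empty set and intersections with closed sets immediate.\<close>

definition analytic_in :: "'a topology \<Rightarrow> 'a set \<Rightarrow> bool" where
  "analytic_in T F \<longleftrightarrow> (\<exists>(C :: (nat \<Rightarrow> nat) set) f.
     closed C \<and> continuous_map (top_of_set C) T f \<and> f ` C = F)"

lemma analytic_inE:
  assumes "analytic_in T F"
  obtains C :: "(nat \<Rightarrow> nat) set" and f
  where "closed C" "continuous_map (top_of_set C) T f" "f ` C = F"
  using assms unfolding analytic_in_def by blast

lemma analytic_in_subset: "analytic_in T F \<Longrightarrow> F \<subseteq> topspace T"
  unfolding analytic_in_def using continuous_map_image_subset_topspace by fastforce

lemma analytic_in_empty: "analytic_in T {}"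
  unfolding analytic_in_def by (intro exI[of _ "{}"]) auto

lemma analytic_in_Int_closed:
  assumes "analytic_in T F" "closedin T D"
  shows "analytic_in T (F \<inter> D)"
proof -
  obtain C :: "(nat \<Rightarrow> nat) set" and f
    where C: "closed C" "continuous_map (top_of_set C) T f" "f ` C = F"
    using assms(1) by (rule analytic_inE)
  let ?C = "{x \<in> C. f x \<in> D}"
  have "closedin (top_of_set C) ?C"
    using closedin_continuous_map_preimage[OF C(2) assms(2)] by simp
  then have "closed ?C" using C(1) closedin_closed_trans by blast
  moreover have "continuous_map (top_of_set ?C) T f"
    using continuous_map_from_subtopology_mono[OF C(2), of ?C] by auto
  moreover have "f ` ?C = F \<inter> D" using C(3) by auto
  ultimately show ?thesis unfolding analytic_in_def by blast
qed

lemma continuous_on_shift: "continuous_on S (\<lambda>\<sigma>::nat \<Rightarrow> nat. (\<lambda>n. \<sigma> (h n)))"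
  by (intro continuous_on_coordinatewise_then_product
      continuous_on_subset[OF continuous_on_product_coordinates]) auto

text \<open>A union is coded by letting the first entry of the sequence select the set.\<close>

lemma analytic_in_UN:
  assumes "\<And>i::nat. analytic_in T (F i)"
  shows "analytic_in T (\<Union>i. F i)"
proof -
  have "\<forall>i. \<exists>(C :: (nat \<Rightarrow> nat) set) f. closed C \<and> continuous_map (top_of_set C) T f \<and> f ` C = F i"
    using assms unfolding analytic_in_def by blast
  then obtain C :: "nat \<Rightarrow> (nat \<Rightarrow> nat) set" and f
    where C: "\<And>i. closed (C i)" "\<And>i. continuous_map (top_of_set (C i)) T (f i)"
      and F: "\<And>i. f i ` C i = F i"
    by metis
  define sh :: "(nat \<Rightarrow> nat) \<Rightarrow> nat \<Rightarrow> nat" where "sh \<sigma> = (\<lambda>n. \<sigma> (Suc n))" for \<sigma>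
  have cont_sh: "continuous_on UNIV sh"
    unfolding sh_def by (rule continuous_on_shift)
  have op0: "open {\<sigma>::nat \<Rightarrow> nat. \<sigma> 0 = i}" for i
    unfolding open_baire_iff by (auto intro!: exI[of _ 1])
  have opsh: "open {\<sigma>. \<sigma> 0 = i \<and> sh \<sigma> \<in> W}" if "open W" for i W
  proof -
    have "open (sh -` W \<inter> UNIV)" using cont_sh that by (simp add: continuous_on_open_vimage)
    then have "open ({\<sigma>. \<sigma> 0 = i} \<inter> sh -` W)" using op0[of i] by (auto intro: open_Int)
    moreover have "{\<sigma>. \<sigma> 0 = i} \<inter> sh -` W = {\<sigma>. \<sigma> 0 = i \<and> sh \<sigma> \<in> W}" by auto
    ultimately show ?thesis by simp
  qed
  let ?C = "{\<sigma>. sh \<sigma> \<in> C (\<sigma> 0)}" and ?f = "\<lambda>\<sigma>. f (\<sigma> 0) (sh \<sigma>)"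
  have "- ?C = (\<Union>i. {\<sigma>. \<sigma> 0 = i \<and> sh \<sigma> \<in> - C i})" by auto
  also have "open \<dots>" using C(1) by (intro open_UN ballI opsh) auto
  finally have "closed ?C" by (simp add: closed_def)
  moreover have "continuous_map (top_of_set ?C) T ?f"
    unfolding continuous_map_def
  proof (intro conjI allI impI)
    show "?f \<in> topspace (top_of_set ?C) \<rightarrow> topspace T"
      using C(2) unfolding continuous_map_def by fastforce
    fix U assume U: "openin T U"
    have "\<forall>i. \<exists>W. open W \<and> {x \<in> C i. f i x \<in> U} = C i \<inter> W"
      using C(2) U unfolding continuous_map_def by (auto simp: openin_open)
    then obtain W where W: "\<And>i. open (W i)" "\<And>i. {x \<in> C i. f i x \<in> U} = C i \<inter> W i" by metis
    have "{x \<in> ?C. ?f x \<in> U} = ?C \<inter> (\<Union>i. {\<sigma>. \<sigma> 0 = i \<and> sh \<sigma> \<in> W i})"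
    proof (intro equalityI subsetI)
      fix \<sigma> assume "\<sigma> \<in> {x \<in> ?C. ?f x \<in> U}"
      then have "\<sigma> \<in> ?C" "sh \<sigma> \<in> W (\<sigma> 0)" using W(2)[of "\<sigma> 0"] by auto
      then show "\<sigma> \<in> ?C \<inter> (\<Union>i. {\<sigma>. \<sigma> 0 = i \<and> sh \<sigma> \<in> W i})" by auto
    next
      fix \<sigma> assume "\<sigma> \<in> ?C \<inter> (\<Union>i. {\<sigma>. \<sigma> 0 = i \<and> sh \<sigma> \<in> W i})"
      then show "\<sigma> \<in> {x \<in> ?C. ?f x \<in> U}" using W(2)[of "\<sigma> 0"] by auto
    qed
    moreover have "open (\<Union>i. {\<sigma>. \<sigma> 0 = i \<and> sh \<sigma> \<in> W i})" using W(1) by (intro open_UN ballI opsh)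
    ultimately show "openin (top_of_set ?C) {x \<in> topspace (top_of_set ?C). ?f x \<in> U}"
      by (auto simp: openin_open)
  qed
  moreover have "?f ` ?C = (\<Union>i. F i)"
  proof -
    have "x \<in> ?f ` ?C" if "x \<in> F i" for x i
    proof -
      have "x \<in> f i ` C i" using that F by simp
      then obtain \<sigma> where "\<sigma> \<in> C i" "x = f i \<sigma>" by (rule imageE)
      then show ?thesis
        by (intro image_eqI[of _ _ "case_nat i \<sigma>"]) (auto simp: sh_def)
    qed
    moreover have "?f \<sigma> \<in> F (\<sigma> 0)" if "\<sigma> \<in> ?C" for \<sigma>
      using that unfolding F[symmetric] by simp
    ultimately show ?thesis by (intro equalityI subsetI) auto
  qed
  ultimately show ?thesis unfolding analytic_in_def by blast
qed

text \<open>A sequence of sequences is again a sequence; it codes a point of the intersection if all its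
  members code the same point, which is a closed condition.\<close>

lemma analytic_in_INT:
  assumes "Hausdorff_space T" "\<And>i::nat. analytic_in T (F i)"
  shows "analytic_in T (\<Inter>i. F i)"
proof -
  have "\<forall>i. \<exists>(C :: (nat \<Rightarrow> nat) set) f. closed C \<and> continuous_map (top_of_set C) T f \<and> f ` C = F i"
    using assms unfolding analytic_in_def by blast
  then obtain C :: "nat \<Rightarrow> (nat \<Rightarrow> nat) set" and f
    where C: "\<And>i. closed (C i)" "\<And>i. continuous_map (top_of_set (C i)) T (f i)"
      and F: "\<And>i. f i ` C i = F i"
    by metis
  define row :: "nat \<Rightarrow> (nat \<Rightarrow> nat) \<Rightarrow> nat \<Rightarrow> nat" where "row i \<sigma> = (\<lambda>n. \<sigma> (prod_encode (i, n)))" for i \<sigma>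
  have cont_row: "continuous_on S (row i)" for i S
    unfolding row_def by (rule continuous_on_shift)
  let ?D = "{\<sigma>. \<forall>i. row i \<sigma> \<in> C i}"
  have closed_D: "closed ?D"
  proof -
    have "closed (row i -` C i)" for i
      using continuous_closed_vimage[OF C(1)] cont_row[of UNIV i] by (simp add: C(1) closed_vimage)
    then have "closed (\<Inter>i. row i -` C i)" by auto
    moreover have "(\<Inter>i. row i -` C i) = ?D" by auto
    ultimately show ?thesis by simp
  qed
  have cont: "continuous_map (top_of_set ?D) T (\<lambda>\<sigma>. f i (row i \<sigma>))" for i
  proof -
    have "continuous_map (top_of_set ?D) (top_of_set (C i)) (row i)"
      using cont_row[of ?D i] by (auto simp: continuous_map_in_subtopology)
    from continuous_map_compose[OF this C(2)] show ?thesis by (simp add: o_def)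
  qed
  let ?C = "{\<sigma> \<in> ?D. \<forall>i. f i (row i \<sigma>) = f 0 (row 0 \<sigma>)}"
  have "closedin (top_of_set ?D) {\<sigma> \<in> ?D. f i (row i \<sigma>) = f 0 (row 0 \<sigma>)}" for i
    using closedin_continuous_maps_eq[OF assms(1) cont cont, of i 0] by simp
  then have "closedin (top_of_set ?D) (\<Inter>i. {\<sigma> \<in> ?D. f i (row i \<sigma>) = f 0 (row 0 \<sigma>)})"
    by (intro closedin_Inter) auto
  moreover have "(\<Inter>i. {\<sigma> \<in> ?D. f i (row i \<sigma>) = f 0 (row 0 \<sigma>)}) = ?C" by auto
  ultimately have "closed ?C" using closed_D closedin_closed_trans by fastforce
  moreover have "continuous_map (top_of_set ?C) T (\<lambda>\<sigma>. f 0 (row 0 \<sigma>))"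
    using continuous_map_from_subtopology_mono[OF cont, of ?C 0] by auto
  moreover have "(\<lambda>\<sigma>. f 0 (row 0 \<sigma>)) ` ?C = (\<Inter>i. F i)"
  proof
    show "(\<lambda>\<sigma>. f 0 (row 0 \<sigma>)) ` ?C \<subseteq> (\<Inter>i. F i)"
    proof clarsimp
      fix \<sigma> i assume *: "\<forall>i. row i \<sigma> \<in> C i" "\<forall>i. f i (row i \<sigma>) = f 0 (row 0 \<sigma>)"
      then have "f i (row i \<sigma>) \<in> F i" unfolding F[symmetric] by simp
      then show "f 0 (row 0 \<sigma>) \<in> F i" using *(2) by metis
    qed
    show "(\<Inter>i. F i) \<subseteq> (\<lambda>\<sigma>. f 0 (row 0 \<sigma>)) ` ?C"
    proof
      fix z assume z: "z \<in> (\<Inter>i. F i)"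
      have "\<forall>i. \<exists>\<tau>. \<tau> \<in> C i \<and> f i \<tau> = z" using z unfolding F[symmetric] by auto
      then obtain \<tau> where \<tau>: "\<And>i. \<tau> i \<in> C i" "\<And>i. f i (\<tau> i) = z" by metis
      define \<sigma> where "\<sigma> = (\<lambda>k. case prod_decode k of (i, n) \<Rightarrow> \<tau> i n)"
      have "row i \<sigma> = \<tau> i" for i unfolding row_def \<sigma>_def by auto
      with \<tau> show "z \<in> (\<lambda>\<sigma>. f 0 (row 0 \<sigma>)) ` ?C"
        by (intro image_eqI[of _ _ \<sigma>]) auto
    qed
  qed
  ultimately show ?thesis unfolding analytic_in_def by blast
qed

lemma analytic_in_Times:
  assumes "analytic_in T A" "analytic_in T' B"
  shows "analytic_in (prod_topology T T') (A \<times> B)"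
proof -
  obtain C :: "(nat \<Rightarrow> nat) set" and f
    where C: "closed C" "continuous_map (top_of_set C) T f" "f ` C = A"
    using assms(1) by (rule analytic_inE)
  obtain D :: "(nat \<Rightarrow> nat) set" and g
    where D: "closed D" "continuous_map (top_of_set D) T' g" "g ` D = B"
    using assms(2) by (rule analytic_inE)
  define ev od :: "(nat \<Rightarrow> nat) \<Rightarrow> nat \<Rightarrow> nat"
    where "ev \<sigma> = (\<lambda>n. \<sigma> (2 * n))" and "od \<sigma> = (\<lambda>n. \<sigma> (2 * n + 1))" for \<sigma>
  have cont: "continuous_on S ev" "continuous_on S od" for S
    unfolding ev_def od_def by (rule continuous_on_shift)+
  let ?E = "{\<sigma>. ev \<sigma> \<in> C \<and> od \<sigma> \<in> D}" and ?h = "\<lambda>\<sigma>. (f (ev \<sigma>), g (od \<sigma>))"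
  have "closed (ev -` C)" "closed (od -` D)"
    using cont[of UNIV] C(1) D(1) by (auto simp: closed_vimage)
  then have "closed (ev -` C \<inter> od -` D)" by auto
  moreover have "ev -` C \<inter> od -` D = ?E" by auto
  ultimately have "closed ?E" by simp
  moreover have "continuous_map (top_of_set ?E) (prod_topology T T') ?h"
  proof (intro continuous_map_pairedI)
    have "continuous_map (top_of_set ?E) (top_of_set C) ev"
      using cont(1)[of ?E] by (auto simp: continuous_map_in_subtopology)
    from continuous_map_compose[OF this C(2)]
    show "continuous_map (top_of_set ?E) T (\<lambda>\<sigma>. f (ev \<sigma>))" by (simp add: o_def)
    have "continuous_map (top_of_set ?E) (top_of_set D) od"
      using cont(2)[of ?E] by (auto simp: continuous_map_in_subtopology)
    from continuous_map_compose[OF this D(2)]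
    show "continuous_map (top_of_set ?E) T' (\<lambda>\<sigma>. g (od \<sigma>))" by (simp add: o_def)
  qed
  moreover have "?h ` ?E = A \<times> B"
  proof -
    have "(f \<sigma>, g \<tau>) \<in> ?h ` ?E" if "\<sigma> \<in> C" "\<tau> \<in> D" for \<sigma> \<tau>
    proof -
      define \<rho> where "\<rho> = (\<lambda>n. if even n then \<sigma> (n div 2) else \<tau> (n div 2))"
      have "ev \<rho> = \<sigma>" "od \<rho> = \<tau>" by (auto simp: ev_def od_def \<rho>_def fun_eq_iff)
      with that show ?thesis by (intro image_eqI[of _ _ \<rho>]) auto
    qed
    then show ?thesis using C(3) D(3) by blast
  qed
  ultimately show ?thesis unfolding analytic_in_def by blast
qed

text \<open>A point of a Polish space is coded by a sequence of members of a fixed countable dense set that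
  converges to it at a prescribed speed. The codes are the sequences whose members are pairwise as
  close as this speed demands, which is a closed condition; by completeness all of them converge.\<close>

lemma analytic_in_topspace:
  assumes "completely_metrizable_space T" "separable_space T"
  shows "analytic_in T (topspace T)"
proof (cases "topspace T = {}")
  case True then show ?thesis using analytic_in_empty by metis
next
  case False
  obtain M d where "Metric_space M d" and T: "T = Metric_space.mtopology M d"
    and compl: "Metric_space.mcomplete M d"
    using assms(1) unfolding completely_metrizable_space_def by blast
  interpret Metric_space M d by fact
  obtain Y where Y: "countable Y" "Y \<subseteq> M" "mtopology closure_of Y = M"
    using assms(2) unfolding separable_space_def T by auto
  have "Y \<noteq> {}" using Y(3) False T by auto
  define y where "y = from_nat_into Y"
  have y: "range y = Y" unfolding y_def using \<open>Y \<noteq> {}\<close> Y(1) by (rule range_from_nat_into)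
  have yM: "y n \<in> M" for n using y Y(2) by auto
  have dense: "\<exists>k. d z (y k) \<le> e" if "z \<in> M" "e > 0" for z e
  proof -
    have "z \<in> mtopology closure_of Y" using that Y(3) by simp
    then have "\<exists>x\<in>Y. x \<in> mball z e"
      using that(2) unfolding metric_closure_of by simp
    then obtain x where x: "x \<in> Y" "x \<in> mball z e" by blast
    obtain k where "x = y k" using x(1) y by (metis imageE)
    then show ?thesis using x(2) by (metis in_mball less_imp_le)
  qed
  define C where "C = {\<sigma>::nat \<Rightarrow> nat. \<forall>n m. d (y (\<sigma> n)) (y (\<sigma> m)) \<le> 1/2^n + 1/2^m}"
  have "closed C"
    unfolding closed_def open_baire_iff
  proof
    fix \<sigma> assume "\<sigma> \<in> - C"
    then obtain n m where nm: "\<not> d (y (\<sigma> n)) (y (\<sigma> m)) \<le> 1/2^n + 1/2^m" unfolding C_def by auto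
    have "\<tau> \<in> - C" if "\<forall>i<Suc (max n m). \<tau> i = \<sigma> i" for \<tau>
    proof -
      have "\<tau> n = \<sigma> n" "\<tau> m = \<sigma> m" using that by auto
      then show ?thesis using nm unfolding C_def by auto metis
    qed
    then show "\<exists>n. \<forall>\<tau>. (\<forall>i<n. \<tau> i = \<sigma> i) \<longrightarrow> \<tau> \<in> - C" by blast
  qed
  have pow: "\<exists>n. 2 / 2^n < (e::real)" if "e > 0" for e
  proof -
    obtain n where "(1/2::real)^n < e/2" using real_arch_pow_inv[of "e/2" "1/2"] \<open>e > 0\<close> by auto
    then show ?thesis by (intro exI[of _ n]) (auto simp: power_divide field_simps)
  qed
  have lim: "\<exists>z\<in>M. \<forall>n. d z (y (\<sigma> n)) \<le> 1/2^n" if \<sigma>: "\<sigma> \<in> C" for \<sigma>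
  proof -
    have "\<exists>N. \<forall>n n'. N \<le> n \<longrightarrow> N \<le> n' \<longrightarrow> d (y (\<sigma> n)) (y (\<sigma> n')) < e" if e: "e > 0" for e
    proof -
      obtain N where N: "2 / 2^N < e" using pow[OF e] by blast
      have "d (y (\<sigma> n)) (y (\<sigma> n')) < e" if "N \<le> n" "N \<le> n'" for n n'
      proof -
        have "d (y (\<sigma> n)) (y (\<sigma> n')) \<le> 1/2^n + 1/2^n'" using \<sigma> unfolding C_def by blast
        also have "\<dots> \<le> 1/2^N + 1/2^N"
          using that by (intro add_mono divide_left_mono power_increasing) auto
        finally show ?thesis using N by simp
      qed
      then show ?thesis by blast
    qed
    then obtain z where z: "limitin mtopology (\<lambda>n. y (\<sigma> n)) z sequentially"
      using compl yM unfolding mcomplete by fastforce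
    have "z \<in> M" using z limitin_topspace by fastforce
    moreover have "d z (y (\<sigma> n)) \<le> 1/2^n" for n
    proof (rule field_le_epsilon)
      fix e :: real assume e: "e > 0"
      obtain N where N: "2 / 2^N < e/2" using pow[of "e/2"] e by auto
      have "\<forall>\<^sub>F m in sequentially. y (\<sigma> m) \<in> M \<and> d (y (\<sigma> m)) z < e/2"
        using z e unfolding limitin_metric by (meson half_gt_zero)
      then obtain m0 where m0: "\<And>m. m \<ge> m0 \<Longrightarrow> d (y (\<sigma> m)) z < e/2"
        unfolding eventually_sequentially by blast
      define m where "m = max m0 N"
      have "d z (y (\<sigma> n)) \<le> d z (y (\<sigma> m)) + d (y (\<sigma> m)) (y (\<sigma> n))"
        using triangle \<open>z \<in> M\<close> yM by blast
      moreover have "d z (y (\<sigma> m)) < e/2"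
        using m0[of m] by (simp add: commute m_def)
      moreover have "d (y (\<sigma> m)) (y (\<sigma> n)) \<le> 1/2^m + 1/2^n"
        using \<sigma> unfolding C_def by blast
      moreover have "1/2^m \<le> 1/(2::real)^N"
        unfolding m_def by (intro divide_left_mono power_increasing) auto
      moreover have "1/(2::real)^N < e/2" using N by (simp add: field_simps)
      ultimately show "d z (y (\<sigma> n)) \<le> 1/2^n + e" by linarith
    qed
    ultimately show ?thesis by blast
  qed
  define f where "f \<sigma> = (SOME z. z \<in> M \<and> (\<forall>n. d z (y (\<sigma> n)) \<le> 1/2^n))" for \<sigma> :: "nat \<Rightarrow> nat"
  have f: "f \<sigma> \<in> M" "d (f \<sigma>) (y (\<sigma> n)) \<le> 1/2^n" if "\<sigma> \<in> C" for \<sigma> n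
  proof -
    have "f \<sigma> \<in> M \<and> (\<forall>n. d (f \<sigma>) (y (\<sigma> n)) \<le> 1/2^n)"
      unfolding f_def by (rule someI_ex) (use lim[OF that] in blast)
    then show "f \<sigma> \<in> M" "d (f \<sigma>) (y (\<sigma> n)) \<le> 1/2^n" by auto
  qed
  have close: "d w z \<le> 2/2^n"
    if "w \<in> M" "z \<in> M" "d w (y k) \<le> 1/2^n" "d z (y k) \<le> 1/2^n" for w z k and n :: nat
    using triangle[OF that(1) yM that(2), of k] that(3,4) by (auto simp: commute)
  have "continuous_map (top_of_set C) mtopology f"
    unfolding continuous_map_to_metric
  proof (intro ballI allI impI)
    fix \<sigma> and e :: real assume "\<sigma> \<in> topspace (top_of_set C)" and e: "e > 0"
    then have \<sigma>: "\<sigma> \<in> C" by simp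
    obtain n where n: "2 / 2^n < e" using pow[OF e] by blast
    have "open {\<tau>::nat \<Rightarrow> nat. \<tau> n = \<sigma> n}"
      unfolding open_baire_iff by (auto intro!: exI[of _ "Suc n"])
    then have "openin (top_of_set C) (C \<inter> {\<tau>. \<tau> n = \<sigma> n})" by (auto simp: openin_open)
    moreover have "f \<tau> \<in> mball (f \<sigma>) e" if "\<tau> \<in> C" "\<tau> n = \<sigma> n" for \<tau>
      using close[of "f \<sigma>" "f \<tau>" "\<sigma> n" n] f(1)[OF \<sigma>] f(1)[OF that(1)] f(2)[OF \<sigma>, of n]
        f(2)[OF that(1), of n] that(2) n
      by (simp add: in_mball)
    ultimately show "\<exists>U. openin (top_of_set C) U \<and> \<sigma> \<in> U \<and> (\<forall>x\<in>U. f x \<in> mball (f \<sigma>) e)"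
      using \<sigma> by (intro exI[of _ "C \<inter> {\<tau>. \<tau> n = \<sigma> n}"]) auto
  qed
  moreover have "f ` C = M"
  proof
    show "f ` C \<subseteq> M" using f(1) by auto
    show "M \<subseteq> f ` C"
    proof
      fix z assume z: "z \<in> M"
      have "\<forall>n. \<exists>k. d z (y k) \<le> 1/2^n" using dense[OF z] by simp
      then obtain \<sigma> where \<sigma>: "\<And>n. d z (y (\<sigma> n)) \<le> 1/2^n" by metis
      have "\<sigma> \<in> C"
        unfolding C_def
      proof (intro CollectI allI)
        fix n m
        have "d (y (\<sigma> n)) (y (\<sigma> m)) \<le> d (y (\<sigma> n)) z + d z (y (\<sigma> m))" by (rule triangle[OF yM z yM])
        then show "d (y (\<sigma> n)) (y (\<sigma> m)) \<le> 1/2^n + 1/2^m"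
          using \<sigma>[of n] \<sigma>[of m] by (simp add: commute)
      qed
      have "d z (f \<sigma>) = 0"
      proof (rule ccontr)
        assume "d z (f \<sigma>) \<noteq> 0"
        then have "d z (f \<sigma>) > 0" by (simp add: less_le)
        from pow[OF this] obtain n where "2 / 2^n < d z (f \<sigma>)" ..
        moreover have "d z (f \<sigma>) \<le> 2/2^n"
          by (rule close[OF z f(1)[OF \<open>\<sigma> \<in> C\<close>] \<sigma> f(2)[OF \<open>\<sigma> \<in> C\<close>]])
        ultimately show False by simp
      qed
      then have "z = f \<sigma>" using z f(1)[OF \<open>\<sigma> \<in> C\<close>] by simp
      with \<open>\<sigma> \<in> C\<close> show "z \<in> f ` C" by blast
    qed
  qed
  ultimately show ?thesis
    unfolding analytic_in_def T topspace_mtopology using \<open>closed C\<close>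
    by (intro exI[of _ C] exI[of _ f] conjI)
qed

section \<open>Capacitability and measurable projection\<close>

text \<open>Each bounded sequence belongs to the open set \<open>W\<close> because of finitely many of its entries, and by
  compactness their number can be bounded. Setting all later entries to 0 keeps a sequence within the
  bounds, so these first entries alone have to be bounded.\<close>

lemma open_superset_bounded_prefix:
  fixes W :: "(nat \<Rightarrow> nat) set"
  assumes "open W" "{\<sigma>. \<forall>i. \<sigma> i \<le> b i} \<subseteq> W"
  obtains n where "{\<sigma>. \<forall>i<n. \<sigma> i \<le> b i} \<subseteq> W"
proof -
  let ?B = "{\<sigma>. \<forall>i. \<sigma> i \<le> b i}"
  define V where "V k = {\<sigma>. \<forall>\<tau>. (\<forall>i<k. \<tau> i = \<sigma> i) \<longrightarrow> \<tau> \<in> W}" for k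
  have "open (V k)" for k
    unfolding open_baire_iff V_def by (auto intro!: exI[of _ k])
  moreover have "?B \<subseteq> (\<Union>k\<in>UNIV. V k)"
  proof
    fix \<sigma> assume "\<sigma> \<in> ?B"
    then have "\<sigma> \<in> W" using assms(2) ..
    then obtain n where "\<forall>\<tau>. (\<forall>i<n. \<tau> i = \<sigma> i) \<longrightarrow> \<tau> \<in> W"
      using assms(1) unfolding open_baire_iff by metis
    then have "\<sigma> \<in> V n" unfolding V_def by simp
    then show "\<sigma> \<in> (\<Union>k\<in>UNIV. V k)" by blast
  qed
  ultimately obtain K where K: "finite K" "?B \<subseteq> (\<Union>k\<in>K. V k)"
    using compactE_image[OF compact_baire_bounded, of UNIV V b] by metis
  obtain n where n: "\<And>k. k \<in> K \<Longrightarrow> k < n" using K(1) finite_nat_set_iff_bounded by auto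
  have "\<tau> \<in> W" if \<tau>: "\<forall>i<n. \<tau> i \<le> b i" for \<tau>
  proof -
    define \<rho> where "\<rho> i = (if i < n then \<tau> i else 0)" for i
    have "\<rho> \<in> ?B" using \<tau> by (auto simp: \<rho>_def)
    then obtain k where "k \<in> K" "\<rho> \<in> V k" using K(2) by blast
    moreover have "\<forall>i<k. \<tau> i = \<rho> i" using n[OF \<open>k \<in> K\<close>] by (auto simp: \<rho>_def)
    ultimately show ?thesis by (auto simp: V_def)
  qed
  then show ?thesis using that by blast
qed

text \<open>A standard probability space, with a Polish topology that generates its measurable sets as a
  parameter.\<close>

locale polish_prob = prob_space M for M :: "'a measure" +
  fixes T :: "'a topology"
  assumes topspace_T: "topspace T = space M"
    and completely_metrizable_T: "completely_metrizable_space T"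
    and separable_T: "separable_space T"
    and sets_borel: "sets M = sigma_sets (space M) {U. openin T U}"
begin

lemma metrizable_T: "metrizable_space T"
  by (simp add: completely_metrizable_T completely_metrizable_imp_metrizable_space)

lemma Hausdorff_T: "Hausdorff_space T"
  by (simp add: metrizable_T metrizable_imp_Hausdorff_space)

lemma openin_sets: "openin T U \<Longrightarrow> U \<in> sets M"
  unfolding sets_borel by (auto intro: sigma_sets.Basic)

lemma closedin_sets: "closedin T D \<Longrightarrow> D \<in> sets M"
proof -
  assume "closedin T D"
  then have "space M - (space M - D) \<in> sets M" "D \<subseteq> space M"
    using openin_sets[of "space M - D"] by (auto simp: closedin_def topspace_T)
  then show ?thesis by (simp add: double_diff)
qed

lemma closedin_outer_regular:
  assumes D: "closedin T D" and c: "emeasure M D < c"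
  obtains U where "openin T U" "D \<subseteq> U" "emeasure M U < c"
proof -
  have "gdelta_in T D" using D metrizable_T by (rule closed_imp_gdelta_in[rotated])
  then obtain C where C: "\<And>n::nat. openin T (C n)" "\<And>n. C (Suc n) \<subseteq> C n" "\<Inter> (range C) = D"
    unfolding gdelta_in_descending by blast
  have "(INF n. emeasure M (C n)) = emeasure M D"
    using INF_emeasure_decseq[of C M] C openin_sets by (auto simp: decseq_Suc_iff)
  with c have "(INF n. emeasure M (C n)) < c" by simp
  then obtain n where "emeasure M (C n) < c" unfolding INF_less_iff by blast
  moreover have "D \<subseteq> C n" using C(3) by blast
  ultimately show ?thesis using C(1) that by blast
qed

lemma countable_base:
  obtains U :: "nat \<Rightarrow> 'a set" where "\<And>i. openin T (U i)"
    "\<And>V x. openin T V \<Longrightarrow> x \<in> V \<Longrightarrow> \<exists>i. x \<in> U i \<and> U i \<subseteq> V"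
proof -
  obtain S d where "Metric_space S d" and T: "T = Metric_space.mtopology S d"
    using metrizable_T unfolding metrizable_space_def by blast
  interpret X: Metric_space S d by fact
  obtain Y where Y: "countable Y" "Y \<subseteq> S" "Abstract_Topology.closure_of X.mtopology Y = S"
    using separable_T unfolding separable_space_def T by auto
  have "Y \<noteq> {}" using Y(3) not_empty topspace_T T by auto
  define y where "y = from_nat_into Y"
  have y: "range y = Y" unfolding y_def using \<open>Y \<noteq> {}\<close> Y(1) by (rule range_from_nat_into)
  define U where "U i = (case prod_decode i of (k, n) \<Rightarrow> X.mball (y k) (1 / Suc n))" for i
  have "openin T (U i)" for i unfolding U_def T by (auto split: prod.split)
  moreover have "\<exists>i. x \<in> U i \<and> U i \<subseteq> V" if V: "openin T V" "x \<in> V" for V x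
  proof -
    obtain r where r: "r > 0" "X.mball x r \<subseteq> V" and x: "x \<in> S"
      using V unfolding T X.openin_mtopology by blast
    obtain n where n: "1 / Suc n < r / 2" using nat_approx_posE[of "r/2"] r(1) by auto
    have "x \<in> Abstract_Topology.closure_of X.mtopology Y" using x Y(3) by simp
    then have "\<exists>z\<in>Y. z \<in> X.mball x (1 / Suc n)"
      unfolding X.metric_closure_of by (simp add: X.in_mball)
    then obtain k where k: "y k \<in> X.mball x (1 / Suc n)" using y by (metis imageE)
    have "X.mball (y k) (1 / Suc n) \<subseteq> X.mball x r"
    proof
      fix z assume "z \<in> X.mball (y k) (1 / Suc n)"
      then have z: "z \<in> S" "d (y k) z < 1 / Suc n" by (auto simp: X.in_mball)
      have "d x z \<le> d x (y k) + d (y k) z" using X.triangle x z k by (auto simp: X.in_mball)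
      then show "z \<in> X.mball x r" using z k n x by (auto simp: X.in_mball)
    qed
    moreover have "x \<in> X.mball (y k) (1 / Suc n)" using k X.commute by (auto simp: X.in_mball)
    ultimately show ?thesis using r(2)
      by (intro exI[of _ "prod_encode (k, n)"]) (auto simp: U_def)
  qed
  ultimately show ?thesis using that by blast
qed

text \<open>The sets that are analytic together with their complement form a sigma-algebra. It contains the
  open sets since these are countable unions of closed sets.\<close>

lemma analytic_in_sets_compl:
  assumes "A \<in> sets M"
  shows "analytic_in T A \<and> analytic_in T (space M - A)"
proof -
  have space: "analytic_in T (space M)"
    using analytic_in_topspace[OF completely_metrizable_T separable_T] by (simp add: topspace_T)
  have closed: "analytic_in T D" if "closedin T D" for D
  proof -
    have "space M \<inter> D = D" using closedin_subset[OF that] topspace_T by auto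
    then show ?thesis using analytic_in_Int_closed[OF space that] by simp
  qed
  from assms show ?thesis
    unfolding sets_borel
  proof (induction rule: sigma_sets.induct)
    case (Basic U)
    then have "fsigma_in T U" using open_imp_fsigma_in metrizable_T by blast
    then obtain C where "\<And>n::nat. closedin T (C n)" "\<Union> (range C) = U"
      unfolding fsigma_in_ascending by blast
    then have "analytic_in T U" using analytic_in_UN[of T C] closed by blast
    moreover have "closedin T (space M - U)" using Basic by (auto simp: topspace_T[symmetric])
    ultimately show ?case using closed by blast
  next
    case Empty then show ?case using analytic_in_empty space by simp
  next
    case (Compl A)
    have "A \<subseteq> space M" using Compl.IH analytic_in_subset topspace_T by blast
    then show ?case using Compl.IH by (simp add: double_diff)
  next
    case (Union A)
    have "space M - (\<Union>i. A i) = (\<Inter>i. space M - A i)" by auto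
    then show ?case
      using analytic_in_UN[of T A] analytic_in_INT[of T "\<lambda>i. space M - A i"] Union.IH Hausdorff_T by auto
  qed
qed

lemma analytic_in_pair_sets:
  assumes "F \<in> sets (M \<Otimes>\<^sub>M M)"
  shows "analytic_in (prod_topology T T) F"
proof -
  let ?P = "prod_topology T T" and ?X = "space M \<times> space M"
  have H: "Hausdorff_space ?P" using Hausdorff_T by (simp add: Hausdorff_space_prod_topology)
  have rect: "analytic_in ?P (A \<times> B)" if "A \<in> sets M" "B \<in> sets M" for A B
    using that analytic_in_sets_compl by (intro analytic_in_Times) auto
  have un: "analytic_in ?P (A \<union> B)" if "analytic_in ?P A" "analytic_in ?P B" for A B
  proof -
    have "(\<Union>i::nat. if i = 0 then A else B) = A \<union> B" by auto
    then show ?thesis using analytic_in_UN[of ?P "\<lambda>i. if i = 0 then A else B"] that by auto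
  qed
  from assms have "analytic_in ?P F \<and> analytic_in ?P (?X - F)"
    unfolding sets_pair_measure
  proof (induction rule: sigma_sets.induct)
    case (Basic F)
    then obtain A B where AB: "A \<in> sets M" "B \<in> sets M" "F = A \<times> B" by blast
    have "?X - A \<times> B = (space M - A) \<times> space M \<union> space M \<times> (space M - B)" by auto
    moreover have "analytic_in ?P \<dots>" using AB(1,2) by (intro un rect) auto
    ultimately show ?case using rect AB by simp
  next
    case Empty then show ?case using analytic_in_empty rect[of "space M" "space M"] by simp
  next
    case (Compl F)
    have "F \<subseteq> ?X" using Compl.IH analytic_in_subset[of ?P F] by (simp add: topspace_T)
    then show ?case using Compl.IH by (simp add: double_diff)
  next
    case (Union F)
    have "?X - (\<Union>i. F i) = (\<Inter>i. ?X - F i)" by auto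
    then show ?case
      using analytic_in_UN[of ?P F] analytic_in_INT[of ?P "\<lambda>i. ?X - F i"] Union.IH H by auto
  qed
  then show ?thesis by blast
qed

text \<open>Outer measure is continuous along increasing unions, so the entries of the sequences in \<open>C\<close> can be
  bounded one after the other while the outer measure of the image stays above \<open>c\<close>. Bounding all
  entries leaves a compact image. Were its measure below \<open>c\<close>, then so were that of an open superset,
  which by the tube lemma above contains the image already when finitely many entries are bounded.\<close>

lemma capacitability:
  assumes C: "closed (C :: (nat \<Rightarrow> nat) set)" and g: "continuous_map (top_of_set C) T g"
    and c: "c < outer_measure_of M (g ` C)"
  shows "\<exists>b. c \<le> emeasure M (g ` (C \<inter> {\<sigma>. \<forall>i. \<sigma> i \<le> b i}))"
proof -
  have sub: "g ` D \<subseteq> space M" if "D \<subseteq> C" for D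
    using continuous_map_image_subset_topspace[OF g] that by (auto simp: topspace_T)
  have "\<exists>D. \<forall>n. ((n = 0 \<longrightarrow> D n = C) \<and> D n \<subseteq> C \<and> c < outer_measure_of M (g ` D n)) \<and>
      (\<exists>k. D (Suc n) = D n \<inter> {\<sigma>. \<sigma> n \<le> k})"
  proof (rule dependent_nat_choice)
    show "\<exists>D. (0 = 0 \<longrightarrow> D = C) \<and> D \<subseteq> C \<and> c < outer_measure_of M (g ` D)" using c by blast
  next
    fix D and n :: nat
    assume D: "(n = 0 \<longrightarrow> D = C) \<and> D \<subseteq> C \<and> c < outer_measure_of M (g ` D)"
    let ?E = "\<lambda>k. g ` (D \<inter> {\<sigma>. \<sigma> n \<le> k})"
    have "(SUP k. outer_measure_of M (?E k)) = outer_measure_of M (\<Union>k. ?E k)"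
      using D by (intro SUP_outer_measure_of_incseq sub) (auto simp: incseq_def intro: order_trans)
    also have "(\<Union>k. ?E k) = g ` D" by auto
    finally have "c < (SUP k. outer_measure_of M (?E k))" using D by simp
    then obtain k where "c < outer_measure_of M (?E k)" unfolding less_SUP_iff by blast
    then show "\<exists>E. ((Suc n = 0 \<longrightarrow> E = C) \<and> E \<subseteq> C \<and> c < outer_measure_of M (g ` E)) \<and>
        (\<exists>k. E = D \<inter> {\<sigma>. \<sigma> n \<le> k})"
      using D by (intro exI[of _ "D \<inter> {\<sigma>. \<sigma> n \<le> k}"]) auto
  qed
  then obtain D where D0: "D 0 = C" and Dc: "\<And>n. c < outer_measure_of M (g ` D n)"
    and "\<forall>n. \<exists>k. D (Suc n) = D n \<inter> {\<sigma>. \<sigma> n \<le> k}" by blast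
  then obtain b where DS: "\<And>n. D (Suc n) = D n \<inter> {\<sigma>. \<sigma> n \<le> b n}" by metis
  have D: "D n = C \<inter> {\<sigma>. \<forall>i<n. \<sigma> i \<le> b i}" for n
    by (induction n) (auto simp: D0 DS less_Suc_eq)
  let ?B = "{\<sigma>. \<forall>i. \<sigma> i \<le> b i}"
  let ?L = "g ` (C \<inter> ?B)"
  have "compact (C \<inter> ?B)" using C compact_baire_bounded by (rule closed_Int_compact)
  then have "compactin (top_of_set C) (C \<inter> ?B)" by (simp add: compactin_subtopology)
  then have "closedin T ?L"
    using g Hausdorff_T image_compactin compactin_imp_closedin by blast
  have "c \<le> emeasure M ?L"
  proof (rule ccontr)
    assume "\<not> c \<le> emeasure M ?L"
    then have "emeasure M ?L < c" by (simp add: not_le)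
    then obtain U where U: "openin T U" "?L \<subseteq> U" "emeasure M U < c"
      using closedin_outer_regular[OF \<open>closedin T ?L\<close>] by blast
    have "openin (top_of_set C) {\<sigma> \<in> C. g \<sigma> \<in> U}"
      using openin_continuous_map_preimage[OF g U(1)] by simp
    then obtain V where V: "open V" "{\<sigma> \<in> C. g \<sigma> \<in> U} = C \<inter> V" by (auto simp: openin_open)
    have "open (- C \<union> V)" using C V(1) by (intro open_Un) (auto simp: closed_def)
    moreover have "?B \<subseteq> - C \<union> V" using U(2) V(2) by blast
    ultimately obtain n where n: "{\<sigma>. \<forall>i<n. \<sigma> i \<le> b i} \<subseteq> - C \<union> V"
      by (rule open_superset_bounded_prefix)
    have "g ` D n \<subseteq> U" using n V(2) unfolding D by blast
    then have "outer_measure_of M (g ` D n) \<le> emeasure M U"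
      using outer_measure_of_mono[of "g ` D n" U M] openin_sets[OF U(1)] by simp
    then show False using Dc[of n] U(3) by simp
  qed
  then show ?thesis by blast
qed

text \<open>Choquet's capacitability theorem for the capacity that sends a set to the outer measure of its
  projection. The compact set lies in the product, not only in the projection; this is what later
  turns measurable graphs into graphs of homeomorphisms between compact sets.\<close>

lemma compact_projection_approx:
  assumes F: "F \<in> sets (M \<Otimes>\<^sub>M M)" and c: "c < outer_measure_of M (Domain F)"
  obtains K where "compactin (prod_topology T T) K" "K \<subseteq> F" "c \<le> emeasure M (Domain K)"
proof -
  obtain C :: "(nat \<Rightarrow> nat) set" and f
    where C: "closed C" and f: "continuous_map (top_of_set C) (prod_topology T T) f" and F': "f ` C = F"
    using analytic_in_pair_sets[OF F] by (rule analytic_inE)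
  have g: "continuous_map (top_of_set C) T (fst \<circ> f)"
    using f continuous_map_fst by (rule continuous_map_compose)
  have Dom: "Domain X = fst ` X" for X :: "('a \<times> 'a) set" by force
  have "(fst \<circ> f) ` C = Domain F" unfolding image_comp[symmetric] F' Dom ..
  then obtain b where b: "c \<le> emeasure M ((fst \<circ> f) ` (C \<inter> {\<sigma>. \<forall>i. \<sigma> i \<le> b i}))"
    using capacitability[OF C g, of c] c by auto
  let ?B = "{\<sigma>. \<forall>i. \<sigma> i \<le> b i}"
  let ?K = "f ` (C \<inter> ?B)"
  have "compact (C \<inter> ?B)" using C compact_baire_bounded by (rule closed_Int_compact)
  then have "compactin (top_of_set C) (C \<inter> ?B)" by (simp add: compactin_subtopology)
  then have "compactin (prod_topology T T) ?K" using f image_compactin by blast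
  moreover have "?K \<subseteq> F" using F' by blast
  moreover have "c \<le> emeasure M (Domain ?K)" using b unfolding Dom by (simp add: image_comp)
  ultimately show ?thesis using that by blast
qed

lemma compactin_sets: "compactin T K \<Longrightarrow> K \<in> sets M"
  by (simp add: Hausdorff_T closedin_sets compactin_imp_closedin)

lemma Domain_compact_sets: "compactin (prod_topology T T) K \<Longrightarrow> Domain K \<in> sets M"
proof -
  assume "compactin (prod_topology T T) K"
  then have "compactin T (fst ` K)" by (rule image_compactin[OF _ continuous_map_fst])
  moreover have "fst ` K = Domain K" by force
  ultimately show ?thesis using compactin_sets by simp
qed

text \<open>The measurable projection theorem: the projections of compact subsets of \<open>F\<close> are compact, and
  their measures come arbitrarily close to the outer measure of the projection of \<open>F\<close>.\<close>

theorem Domain_completion_sets: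
  assumes F: "F \<in> sets (M \<Otimes>\<^sub>M M)"
  shows "Domain F \<in> sets (completion M)"
proof -
  have sub: "Domain F \<subseteq> space M" using sets.sets_into_space[OF F] by (auto simp: space_pair_measure)
  obtain E where E: "E \<in> sets M" "Domain F \<subseteq> E" "outer_measure_of M (Domain F) = emeasure M E"
    using outer_measure_of_attain[OF sub] by blast
  define \<C> where "\<C> = {B \<in> sets M. B \<subseteq> Domain F}"
  have ex: "\<exists>B\<in>\<C>. c \<le> emeasure M B" if c: "c < emeasure M E" for c
  proof -
    obtain K where K: "compactin (prod_topology T T) K" "K \<subseteq> F" "c \<le> emeasure M (Domain K)"
      using compact_projection_approx[OF F] c unfolding E(3)[symmetric] by blast
    then show ?thesis using Domain_compact_sets by (auto simp: \<C>_def intro!: bexI[of _ "Domain K"])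
  qed
  have "emeasure M E \<le> (SUP B\<in>\<C>. emeasure M B)"
  proof (rule dense_le)
    fix c assume "c < emeasure M E"
    then obtain B where "B \<in> \<C>" "c \<le> emeasure M B" using ex by blast
    then show "c \<le> (SUP B\<in>\<C>. emeasure M B)" by (rule SUP_upper2)
  qed
  moreover have ne: "emeasure M ` \<C> \<noteq> {}" by (auto simp: \<C>_def intro: exI[of _ "{}"])
  obtain f where f: "range f \<subseteq> emeasure M ` \<C>" "(SUP B\<in>\<C>. emeasure M B) = (SUP i::nat. f i)"
    using ennreal_Sup_countable_SUP[OF ne] by auto
  have "\<forall>i. \<exists>B\<in>\<C>. f i = emeasure M B" using f(1) by auto
  then obtain B where B: "\<And>i. B i \<in> \<C>" "\<And>i. f i = emeasure M (B i)" by metis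
  define G where "G = (\<Union>i. B i)"
  have G: "G \<in> sets M" "G \<subseteq> Domain F" using B(1) by (auto simp: G_def \<C>_def)
  have "f i \<le> emeasure M G" for i
    unfolding B(2) using G(1) by (intro emeasure_mono) (auto simp: G_def)
  then have "(SUP i. f i) \<le> emeasure M G" by (rule SUP_least)
  ultimately have "emeasure M E \<le> emeasure M G" unfolding f(2) by (rule order_trans)
  then have "emeasure M (E - G) = 0"
    using emeasure_Diff[of M G E] G E emeasure_mono[of G E M] by (auto simp: diff_eq_0_iff_ennreal)
  then have "E - G \<in> null_sets M" using E G by auto
  then have "Domain F - G \<in> null_sets (completion M)"
    using E(2) G(2) by (intro null_sets_completion_subset[of "Domain F - G" "E - G"] null_sets_completionI) auto
  then have "G \<union> (Domain F - G) \<in> sets (completion M)" using G(1) by (intro sets.Un) auto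
  moreover have "G \<union> (Domain F - G) = Domain F" using G(2) by auto
  ultimately show ?thesis by simp
qed

section \<open>Relations up to null sets\<close>

lemma outer_measure_of_eq_completion:
  assumes "A \<in> sets (completion M)"
  shows "outer_measure_of M A = emeasure (completion M) A"
proof (rule antisym)
  obtain B where B: "A \<subseteq> B" "B \<in> sets M" "B - A \<in> null_sets (completion M)"
    "emeasure (completion M) A = emeasure M B"
    using assms by (rule completion_upper)
  then show "outer_measure_of M A \<le> emeasure (completion M) A"
    unfolding B(4) outer_measure_of_def by (intro INF_lower) auto
  show "emeasure (completion M) A \<le> outer_measure_of M A"
    unfolding outer_measure_of_def
  proof (rule INF_greatest)
    fix B assume "B \<in> {B \<in> sets M. A \<subseteq> B}"
    then have "emeasure (completion M) A \<le> emeasure (completion M) B" "B \<in> sets M"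
      by (auto intro!: emeasure_mono simp del: emeasure_completion)
    then show "emeasure (completion M) A \<le> emeasure M B" by simp
  qed
qed

lemma completion_inner:
  assumes "A \<in> sets (completion M)"
  obtains B where "B \<in> sets M" "B \<subseteq> A" "AE x in M. x \<in> A \<longrightarrow> x \<in> B"
proof
  show "main_part M A \<in> sets M" using assms by (rule main_part_sets)
  show "main_part M A \<subseteq> A" using main_part_null_part_Un[OF assms] by blast
  show "AE x in M. x \<in> A \<longrightarrow> x \<in> main_part M A" using AE_in_main_part[OF assms] by auto
qed

lemma AE_notin_iff_completion:
  assumes "A \<in> sets (completion M)"
  shows "(AE x in M. x \<notin> A) \<longleftrightarrow> emeasure (completion M) A = 0"
proof -
  have "A \<subseteq> space M" using sets.sets_into_space[OF assms] by simp
  then show ?thesis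
    using AE_iff_null_sets[OF assms] assms by (simp add: AE_completion_iff null_sets_def del: emeasure_completion)
qed

lemma pair_sets_subset: "A \<in> sets (M \<Otimes>\<^sub>M M) \<Longrightarrow> A \<subseteq> space M \<times> space M"
  by (drule sets.sets_into_space) (simp add: space_pair_measure)

text \<open>Where the integrand in \<^const>\<open>rel_measure\<close> is not known to be measurable, a vanishing integral only
  says that the measurable subsets of the projection of \<open>F\<close> are null. The projection theorem makes the
  projection itself null. Every statement about null sets of pairs can now be read pointwise.\<close>

lemma rel_measure_eq_0_iff:
  assumes F: "F \<in> sets (M \<Otimes>\<^sub>M M)"
  shows "rel_measure M F = 0 \<longleftrightarrow> (AE x in M. \<forall>y. (x, y) \<notin> F)"
proof
  assume 0: "rel_measure M F = 0"
  obtain B where B: "B \<in> sets M" "B \<subseteq> Domain F" "AE x in M. x \<in> Domain F \<longrightarrow> x \<in> B"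
    using completion_inner[OF Domain_completion_sets[OF F]] by blast
  have "emeasure M B = (\<integral>\<^sup>+x. indicator B x \<partial>M)" using B(1) by simp
  also have "\<dots> \<le> rel_measure M F"
    unfolding rel_measure_def
  proof (rule nn_integral_mono)
    fix x
    show "indicator B x \<le> emeasure (count_space UNIV) {y. (x, y) \<in> F}"
    proof (cases "x \<in> B")
      case True
      then obtain y where "(x, y) \<in> F" using B(2) by blast
      have "1 = emeasure (count_space UNIV) {y}" by simp
      also have "\<dots> \<le> emeasure (count_space UNIV) {y. (x, y) \<in> F}"
        using \<open>(x, y) \<in> F\<close> by (intro emeasure_mono) auto
      finally show ?thesis using True by simp
    qed simp
  qed
  finally have "emeasure M B = 0" using 0 by simp
  then have "AE x in M. x \<notin> B" using B(1) by (intro AE_not_in) auto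
  with B(3) show "AE x in M. \<forall>y. (x, y) \<notin> F" by eventually_elim blast
next
  assume "AE x in M. \<forall>y. (x, y) \<notin> F"
  then have "AE x in M. emeasure (count_space UNIV) {y. (x, y) \<in> F} = 0"
    by eventually_elim simp
  then have "rel_measure M F = (\<integral>\<^sup>+x. 0 \<partial>M)"
    unfolding rel_measure_def by (rule nn_integral_cong_AE)
  then show "rel_measure M F = 0" by simp
qed

lemma ae_subset_iff:
  assumes "A \<in> sets (M \<Otimes>\<^sub>M M)" "B \<in> sets (M \<Otimes>\<^sub>M M)"
  shows "ae_subset M A B \<longleftrightarrow> (AE x in M. \<forall>y. (x, y) \<in> A \<longrightarrow> (x, y) \<in> B)"
  unfolding ae_subset_def using rel_measure_eq_0_iff[OF sets.Diff[OF assms]] by simp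

lemma ae_eq_iff:
  assumes "A \<in> sets (M \<Otimes>\<^sub>M M)" "B \<in> sets (M \<Otimes>\<^sub>M M)"
  shows "ae_eq M A B \<longleftrightarrow> (AE x in M. \<forall>y. (x, y) \<in> A \<longleftrightarrow> (x, y) \<in> B)"
proof -
  have "(A - B) \<union> (B - A) \<in> sets (M \<Otimes>\<^sub>M M)" using assms by auto
  from rel_measure_eq_0_iff[OF this] show ?thesis unfolding ae_eq_def
    by (simp, intro AE_cong) blast
qed

lemma borel_equivD:
  assumes "borel_equiv M E"
  shows "E \<in> sets (M \<Otimes>\<^sub>M M)" "equiv (space M) E" "sym E" "trans E"
    "x \<in> space M \<Longrightarrow> (x, x) \<in> E" "(x, y) \<in> E \<Longrightarrow> x \<in> space M \<and> y \<in> space M"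
    "(x, y) \<in> E \<Longrightarrow> (y, x) \<in> E" "(x, y) \<in> E \<Longrightarrow> (y, z) \<in> E \<Longrightarrow> (x, z) \<in> E"
proof -
  show E: "E \<in> sets (M \<Otimes>\<^sub>M M)" "equiv (space M) E" using assms by (auto simp: borel_equiv_def)
  then show s: "sym E" "trans E" by (auto simp: equiv_def)
  show "x \<in> space M \<Longrightarrow> (x, x) \<in> E" using E(2) by (simp add: equiv_def refl_on_def)
  show "(x, y) \<in> E \<Longrightarrow> x \<in> space M \<and> y \<in> space M" using pair_sets_subset[OF E(1)] by blast
  show "(x, y) \<in> E \<Longrightarrow> (y, x) \<in> E" using s(1) by (rule symD)
  show "(x, y) \<in> E \<Longrightarrow> (y, z) \<in> E \<Longrightarrow> (x, z) \<in> E" using s(2) by (meson transD)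
qed

lemma borel_equivI:
  assumes E: "E \<in> sets (M \<Otimes>\<^sub>M M)" and "\<And>x. x \<in> space M \<Longrightarrow> (x, x) \<in> E"
    "\<And>x y. (x, y) \<in> E \<Longrightarrow> (y, x) \<in> E"
    "\<And>x y z. (x, y) \<in> E \<Longrightarrow> (y, z) \<in> E \<Longrightarrow> (x, z) \<in> E"
  shows "borel_equiv M E"
  unfolding borel_equiv_def
proof
  show "equiv (space M) E"
    unfolding equiv_def
  proof (intro conjI)
    show "E \<subseteq> space M \<times> space M" by (rule pair_sets_subset[OF E])
    show "refl_on (space M) E" unfolding refl_on_def using assms(2) by blast
    show "sym E" by (rule symI) (rule assms(3))
    show "trans E" by (rule transI) (rule assms(4))
  qed
qed (rule E)

lemma subequivD: "subequiv M E F \<Longrightarrow> borel_equiv M F" "subequiv M E F \<Longrightarrow> F \<subseteq> E"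
  "subequiv M E F \<Longrightarrow> F \<in> sets (M \<Otimes>\<^sub>M M)"
  by (simp_all add: subequiv_def borel_equiv_def)

lemma borel_equiv_Int:
  assumes E: "borel_equiv M E" and F: "borel_equiv M F"
  shows "borel_equiv M (E \<inter> F)"
proof (rule borel_equivI)
  show "E \<inter> F \<in> sets (M \<Otimes>\<^sub>M M)" using E F borel_equivD(1) by simp
next
  fix x assume "x \<in> space M"
  then show "(x, x) \<in> E \<inter> F" using borel_equivD(5)[OF E] borel_equivD(5)[OF F] by simp
next
  fix x y assume "(x, y) \<in> E \<inter> F"
  then show "(y, x) \<in> E \<inter> F" using borel_equivD(7)[OF E] borel_equivD(7)[OF F] by simp
next
  fix x y z assume "(x, y) \<in> E \<inter> F" "(y, z) \<in> E \<inter> F"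
  then show "(x, z) \<in> E \<inter> F" using borel_equivD(8)[OF E, of x y z] borel_equivD(8)[OF F, of x y z] by simp
qed

lemma ae_eq_UN_iff:
  assumes E: "borel_equiv M E" and F: "\<And>n::nat. F n \<in> sets (M \<Otimes>\<^sub>M M)" "\<And>n. F n \<subseteq> E"
  shows "ae_eq M E (\<Union>n. F n) \<longleftrightarrow> (AE x in M. \<forall>y. (x, y) \<in> E \<longrightarrow> (\<exists>n. (x, y) \<in> F n))"
proof -
  have "(\<Union>n. F n) \<in> sets (M \<Otimes>\<^sub>M M)" using F(1) by auto
  moreover have "((x, y) \<in> E \<longleftrightarrow> (x, y) \<in> (\<Union>n. F n)) \<longleftrightarrow> ((x, y) \<in> E \<longrightarrow> (\<exists>n. (x, y) \<in> F n))" for x y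
    using F(2) by blast
  ultimately show ?thesis
    using ae_eq_iff[OF borel_equivD(1)[OF E], of "\<Union>n. F n"] by simp
qed

lemma hyperfiniteI:
  fixes F :: "nat \<Rightarrow> ('a \<times> 'a) set"
  assumes E: "borel_equiv M E" and F: "\<And>n. borel_equiv M (F n)" "\<And>n. F n \<subseteq> E"
    "\<And>n x. x \<in> space M \<Longrightarrow> finite (F n `` {x})" "\<And>n. F n \<subseteq> F (Suc n)"
    and AE: "AE x in M. \<forall>y. (x, y) \<in> E \<longrightarrow> (\<exists>n. (x, y) \<in> F n)"
  shows "hyperfinite M E"
proof -
  have "ae_eq M E (\<Union>n. F n)"
    using AE unfolding ae_eq_UN_iff[OF E borel_equivD(1)[OF F(1)] F(2)] .
  moreover have "subequiv M E (F n)" for n using F(1,2) by (simp add: subequiv_def)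
  ultimately show ?thesis unfolding hyperfinite_def using F(3,4) by (intro exI[of _ F]) simp
qed

lemma hyperfiniteE:
  assumes E: "borel_equiv M E" and hyp: "hyperfinite M E"
  obtains F :: "nat \<Rightarrow> ('a \<times> 'a) set" where "\<And>n. borel_equiv M (F n)" "\<And>n. F n \<subseteq> E"
    "\<And>n x. x \<in> space M \<Longrightarrow> finite (F n `` {x})" "\<And>n. F n \<subseteq> F (Suc n)"
    "AE x in M. \<forall>y. (x, y) \<in> E \<longrightarrow> (\<exists>n. (x, y) \<in> F n)"
proof -
  from hyp obtain F :: "nat \<Rightarrow> ('a \<times> 'a) set"
    where F: "\<And>n. subequiv M E (F n)" "\<And>n x. x \<in> space M \<Longrightarrow> finite (F n `` {x})"
      "\<And>n. F n \<subseteq> F (Suc n)" "ae_eq M E (\<Union>n. F n)"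
    unfolding hyperfinite_def by metis
  have "AE x in M. \<forall>y. (x, y) \<in> E \<longrightarrow> (\<exists>n. (x, y) \<in> F n)"
    using F(4) unfolding ae_eq_UN_iff[OF E subequivD(3)[OF F(1)] subequivD(2)[OF F(1)]] .
  then show ?thesis using that subequivD(1,2)[OF F(1)] F(2,3) by blast
qed

lemma hyperfinite_ae_subset:
  assumes T: "borel_equiv M E" "hyperfinite M E" and Q: "borel_equiv M Q" "ae_subset M Q E"
  shows "hyperfinite M Q"
proof -
  obtain F :: "nat \<Rightarrow> ('a \<times> 'a) set" where F: "\<And>n. borel_equiv M (F n)" "\<And>n. F n \<subseteq> E"
    "\<And>n x. x \<in> space M \<Longrightarrow> finite (F n `` {x})" "\<And>n. F n \<subseteq> F (Suc n)"
    and AE: "AE x in M. \<forall>y. (x, y) \<in> E \<longrightarrow> (\<exists>n. (x, y) \<in> F n)"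
    using T by (rule hyperfiniteE) blast
  have "AE x in M. \<forall>y. (x, y) \<in> Q \<longrightarrow> (x, y) \<in> E"
    using Q(2) unfolding ae_subset_iff[OF borel_equivD(1)[OF Q(1)] borel_equivD(1)[OF T(1)]] .
  with AE have "AE x in M. \<forall>y. (x, y) \<in> Q \<longrightarrow> (\<exists>n. (x, y) \<in> F n \<inter> Q)"
    by eventually_elim blast
  moreover have "finite ((F n \<inter> Q) `` {x})" if "x \<in> space M" for n x
    using F(3)[OF that] by (rule finite_subset[rotated]) auto
  moreover have "F n \<inter> Q \<subseteq> F (Suc n) \<inter> Q" for n using F(4)[of n] by blast
  ultimately show ?thesis
    using hyperfiniteI[OF Q(1), of "\<lambda>n. F n \<inter> Q"] borel_equiv_Int[OF F(1) Q(1)] by blast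
qed

end

section \<open>Invariance along partial isomorphisms\<close>

locale invariant_equiv = polish_prob +
  fixes R :: "('a \<times> 'a) set"
  assumes R: "borel_equiv M R" and invariant: "invariant_measure M R"
begin

lemma full_groupD:
  assumes "\<phi> \<in> carrier (borel_full_group M R)"
  shows "bij_betw \<phi> (space M) (space M)" "\<phi> \<in> extensional (space M)"
    "\<phi> \<in> measurable M M" "inv_into (space M) \<phi> \<in> measurable M M"
    "x \<in> space M \<Longrightarrow> (x, \<phi> x) \<in> R" "x \<in> space M \<Longrightarrow> \<phi> x \<in> space M" "distr M M \<phi> = M"
  using assms invariant borel_equivD(6)[OF R]
  by (auto simp: borel_full_group_def Bij_def invariant_measure_def)

lemma full_group_AE:
  assumes "\<phi> \<in> carrier (borel_full_group M R)" "AE x in M. P x"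
  shows "AE x in M. P (\<phi> x)"
proof -
  have "AE x in distr M M \<phi>. P x" unfolding full_groupD(7)[OF assms(1)] by (rule assms(2))
  with full_groupD(3)[OF assms(1)] show ?thesis by (rule AE_distrD)
qed

text \<open>Preimages of Borel sets under a partial function with compact graph are Borel: preimages of closed
  sets are projections of compact sets, and single-valuedness takes care of complements.\<close>

lemma compact_rel_vimage_sets:
  assumes K: "compactin (prod_topology T T) K" "single_valued K" and B: "B \<in> sets M"
  shows "Domain (K \<inter> UNIV \<times> B) \<in> sets M"
  using B unfolding sets_borel
proof (induction rule: sigma_sets.induct)
  case (Basic U)
  have sub: "K \<subseteq> space M \<times> space M" using compactin_subset_topspace[OF K(1)] by (simp add: topspace_T)
  have "fsigma_in T U" using open_imp_fsigma_in metrizable_T Basic by blast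
  then obtain C where C: "\<And>n::nat. closedin T (C n)" "\<Union> (range C) = U"
    unfolding fsigma_in_ascending by blast
  have "Domain (K \<inter> UNIV \<times> C n) \<in> sets M" for n
  proof -
    have "closedin (prod_topology T T) (topspace T \<times> C n)"
      using C(1) by (simp add: closedin_prod_Times_iff)
    with K(1) have "compactin (prod_topology T T) (K \<inter> topspace T \<times> C n)"
      by (rule compact_Int_closedin)
    moreover have "K \<inter> topspace T \<times> C n = K \<inter> UNIV \<times> C n" using sub by (auto simp: topspace_T)
    ultimately show ?thesis using Domain_compact_sets by simp
  qed
  moreover have "Domain (K \<inter> UNIV \<times> U) = (\<Union>n. Domain (K \<inter> UNIV \<times> C n))" using C(2) by blast
  ultimately show ?case unfolding sets_borel[symmetric] by auto
next
  case Empty show ?case by (simp add: sigma_sets.Empty)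
next
  case (Compl B)
  have sub: "K \<subseteq> space M \<times> space M" using compactin_subset_topspace[OF K(1)] by (simp add: topspace_T)
  have "Domain (K \<inter> UNIV \<times> (space M - B)) = Domain K - Domain (K \<inter> UNIV \<times> B)"
    using K(2) sub unfolding single_valued_def by blast
  then show ?case using Compl.IH Domain_compact_sets[OF K(1)] unfolding sets_borel[symmetric] by auto
next
  case (Union B)
  have "Domain (K \<inter> UNIV \<times> (\<Union>n. B n)) = (\<Union>n. Domain (K \<inter> UNIV \<times> B n))" by blast
  then show ?case using Union.IH unfolding sets_borel[symmetric] by auto
qed

text \<open>A compact partial isomorphism with disjoint domain and range extends to a Borel involution
  that exchanges the two.\<close>

lemma emeasure_Domain_eq_Range_compact:
  assumes K: "compactin (prod_topology T T) K" "single_valued K" "single_valued (K\<inverse>)"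
    and sub: "K \<subseteq> R" and disj: "Domain K \<inter> Range K = {}"
  shows "emeasure M (Domain K) = emeasure M (Range K)"
proof -
  let ?S = "K \<union> K\<inverse>"
  have Kc: "compactin (prod_topology T T) (K\<inverse>)"
  proof -
    have "compactin (prod_topology T T) ((\<lambda>z. (snd z, fst z)) ` K)"
      using K(1) by (rule image_compactin) (intro continuous_map_pairedI continuous_map_fst continuous_map_snd)
    moreover have "(\<lambda>z. (snd z, fst z)) ` K = K\<inverse>" by force
    ultimately show ?thesis by simp
  qed
  have D: "Domain K \<in> sets M" and E: "Range K \<in> sets M"
    using Domain_compact_sets[OF K(1)] Domain_compact_sets[OF Kc] by auto
  have Ksp: "K \<subseteq> space M \<times> space M" using sub borel_equivD(6)[OF R] by auto
  have sv: "single_valued ?S" using K(2,3) disj unfolding single_valued_def by blast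
  define \<iota> where "\<iota> = (\<lambda>x\<in>space M. if x \<in> Domain ?S then THE y. (x, y) \<in> ?S else x)"
  have \<iota>S: "\<iota> x = y" if "(x, y) \<in> ?S" for x y
  proof -
    have "x \<in> space M" using that Ksp by auto
    moreover have "(THE y. (x, y) \<in> ?S) = y" using that sv unfolding single_valued_def by blast
    ultimately show ?thesis using that unfolding \<iota>_def by auto
  qed
  have \<iota>id: "\<iota> x = x" if "x \<notin> Domain ?S" "x \<in> space M" for x using that by (simp add: \<iota>_def)
  have inv: "\<iota> (\<iota> x) = x" and \<iota>sp: "\<iota> x \<in> space M" and \<iota>R: "(x, \<iota> x) \<in> R" if x: "x \<in> space M" for x
  proof -
    consider "x \<notin> Domain ?S" | y where "(x, y) \<in> ?S" by blast
    then have "\<iota> (\<iota> x) = x \<and> \<iota> x \<in> space M \<and> (x, \<iota> x) \<in> R"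
    proof cases
      case 1 then show ?thesis using \<iota>id x borel_equivD(5)[OF R] by simp
    next
      case 2
      then have "(y, x) \<in> ?S" by auto
      then have "\<iota> x = y" "\<iota> y = x" using 2 \<iota>S by auto
      then show ?thesis using 2 Ksp sub borel_equivD(7)[OF R] by auto
    qed
    then show "\<iota> (\<iota> x) = x" "\<iota> x \<in> space M" "(x, \<iota> x) \<in> R" by auto
  qed
  have bij: "bij_betw \<iota> (space M) (space M)"
    by (rule bij_betw_byWitness[of _ \<iota>]) (use inv \<iota>sp in auto)
  have meas: "\<iota> \<in> measurable M M"
  proof (rule measurableI)
    fix B assume B: "B \<in> sets M"
    have "\<iota> -` B \<inter> space M = Domain (K \<inter> UNIV \<times> B) \<union> Domain (K\<inverse> \<inter> UNIV \<times> B) \<union> (B - (Domain K \<union> Range K))"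
      (is "?l = ?r")
    proof (intro equalityI subsetI)
      fix x assume "x \<in> ?l"
      then have x: "\<iota> x \<in> B" "x \<in> space M" by auto
      consider "x \<notin> Domain ?S" | y where "(x, y) \<in> ?S" by blast
      then show "x \<in> ?r"
      proof cases
        case 1 then show ?thesis using x \<iota>id[of x] by auto
      next
        case 2
        then have "y \<in> B" using x \<iota>S by simp
        then show ?thesis using 2 by blast
      qed
    next
      fix x assume x: "x \<in> ?r"
      consider y where "(x, y) \<in> ?S" "y \<in> B" | "x \<in> B" "x \<notin> Domain ?S" using x by blast
      then show "x \<in> ?l"
      proof cases
        case 1 then show ?thesis using \<iota>S Ksp by auto
      next
        case 2 then show ?thesis using \<iota>id[of x] sets.sets_into_space[OF B] by auto
      qed
    qed
    then show "\<iota> -` B \<inter> space M \<in> sets M"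
      using compact_rel_vimage_sets[OF K(1,2) B] compact_rel_vimage_sets[OF Kc K(3) B] B D E by simp
  qed (use \<iota>sp in auto)
  have "inv_into (space M) \<iota> x = \<iota> x" if "x \<in> space M" for x
    using inv_into_f_eq[of \<iota> "space M" "\<iota> x" x] bij that \<iota>sp inv by (auto simp: bij_betw_def)
  then have "inv_into (space M) \<iota> \<in> measurable M M"
    using meas measurable_cong[of M "inv_into (space M) \<iota>" \<iota> M] by simp
  then have "\<iota> \<in> carrier (borel_full_group M R)"
    using bij meas \<iota>R unfolding borel_full_group_def Bij_def by (auto simp: \<iota>_def)
  then have "emeasure M (Range K) = emeasure (distr M M \<iota>) (Range K)" using full_groupD(7) by simp
  also have "\<dots> = emeasure M (\<iota> -` Range K \<inter> space M)" using meas E by (rule emeasure_distr)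
  also have "\<iota> -` Range K \<inter> space M = Domain K"
  proof (intro equalityI subsetI)
    fix x assume "x \<in> \<iota> -` Range K \<inter> space M"
    then have x: "\<iota> x \<in> Range K" "x \<in> space M" by auto
    then obtain z where "(z, \<iota> x) \<in> K" by blast
    then have "\<iota> (\<iota> x) = z" by (intro \<iota>S) simp
    then have "z = x" using inv[OF x(2)] by simp
    then show "x \<in> Domain K" using \<open>(z, \<iota> x) \<in> K\<close> by (simp add: DomainI)
  next
    fix x assume "x \<in> Domain K"
    then obtain y where "(x, y) \<in> K" by blast
    then show "x \<in> \<iota> -` Range K \<inter> space M" using \<iota>S Ksp by auto
  qed
  finally show ?thesis ..
qed

lemma Range_completion_sets: "F \<in> sets (M \<Otimes>\<^sub>M M) \<Longrightarrow> Range F \<in> sets (completion M)"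
proof -
  assume F: "F \<in> sets (M \<Otimes>\<^sub>M M)"
  have "(\<lambda>(x, y). (y, x)) -` F \<inter> space (M \<Otimes>\<^sub>M M) \<in> sets (M \<Otimes>\<^sub>M M)"
    using F by (intro measurable_sets[of _ _ "M \<Otimes>\<^sub>M M"]) auto
  moreover have "(\<lambda>(x, y). (y, x)) -` F \<inter> space (M \<Otimes>\<^sub>M M) = F\<inverse>"
    using pair_sets_subset[OF F] by (auto simp: space_pair_measure)
  ultimately show ?thesis using Domain_completion_sets[of "F\<inverse>"] by simp
qed

text \<open>Invariance of the measure speaks about everywhere defined Borel isomorphisms. Partial isomorphisms
  are reached through their compact parts, whose domains exhaust the measure of the domain.\<close>

lemma emeasure_Domain_le_Range:
  assumes G: "G \<in> sets (M \<Otimes>\<^sub>M M)" "single_valued G" "single_valued (G\<inverse>)"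
    and sub: "G \<subseteq> R" and disj: "Domain G \<inter> Range G = {}"
  shows "emeasure (completion M) (Domain G) \<le> emeasure (completion M) (Range G)"
proof (rule dense_le)
  fix c assume "c < emeasure (completion M) (Domain G)"
  then have "c < outer_measure_of M (Domain G)"
    using outer_measure_of_eq_completion[OF Domain_completion_sets[OF G(1)]] by simp
  then obtain K where K: "compactin (prod_topology T T) K" "K \<subseteq> G" "c \<le> emeasure M (Domain K)"
    using compact_projection_approx[OF G(1)] by blast
  have "single_valued K" "single_valued (K\<inverse>)" "Domain K \<inter> Range K = {}"
    using K(2) G(2,3) disj by (auto simp: single_valued_def) blast+
  with K sub have "emeasure M (Domain K) = emeasure M (Range K)"
    by (intro emeasure_Domain_eq_Range_compact) auto
  also have "\<dots> \<le> outer_measure_of M (Range G)"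
    using K(2) Range_mono[of K G] unfolding outer_measure_of_def
    by (intro INF_greatest emeasure_mono) auto
  also have "\<dots> = emeasure (completion M) (Range G)"
    by (rule outer_measure_of_eq_completion[OF Range_completion_sets[OF G(1)]])
  finally show "c \<le> emeasure (completion M) (Range G)" using K(3) by (rule order_trans[rotated])
qed

end

context polish_prob begin

section \<open>Recurrence\<close>

text \<open>A countable family of this kind replaces a Borel linear order when a point has to be singled out
  from a finite set in a measurable way: the point is the only one in some member of the family. The
  last clause lets this member be disjoint from another one around a given different point.\<close>

definition separating :: "(nat \<Rightarrow> 'a set) \<Rightarrow> bool" where
  "separating U \<longleftrightarrow> (\<forall>i. U i \<in> sets M) \<and>
     (\<forall>x\<in>space M. \<forall>A. finite A \<longrightarrow> x \<notin> A \<longrightarrow> (\<exists>i. x \<in> U i \<and> U i \<inter> A = {})) \<and>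
     (\<forall>x\<in>space M. \<forall>y\<in>space M. \<forall>A. x \<noteq> y \<longrightarrow> finite A \<longrightarrow> x \<notin> A \<longrightarrow>
       (\<exists>i j. x \<in> U i \<and> U i \<inter> A = {} \<and> y \<in> U j \<and> U i \<inter> U j = {}))"

lemma separatingD:
  assumes "separating U"
  shows "U i \<in> sets M"
    "x \<in> space M \<Longrightarrow> finite A \<Longrightarrow> x \<notin> A \<Longrightarrow> \<exists>i. x \<in> U i \<and> U i \<inter> A = {}"
    "x \<in> space M \<Longrightarrow> y \<in> space M \<Longrightarrow> x \<noteq> y \<Longrightarrow> finite A \<Longrightarrow> x \<notin> A \<Longrightarrow>
       \<exists>i j. x \<in> U i \<and> U i \<inter> A = {} \<and> y \<in> U j \<and> U i \<inter> U j = {}"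
proof -
  note * = assms[unfolded separating_def]
  show "U i \<in> sets M" using * by simp
  show "\<exists>i. x \<in> U i \<and> U i \<inter> A = {}" if "x \<in> space M" "finite A" "x \<notin> A"
    using *[THEN conjunct2, THEN conjunct1, rule_format, OF that] .
  show "\<exists>i j. x \<in> U i \<and> U i \<inter> A = {} \<and> y \<in> U j \<and> U i \<inter> U j = {}"
    if "x \<in> space M" "y \<in> space M" "x \<noteq> y" "finite A" "x \<notin> A"
    using *[THEN conjunct2, THEN conjunct2, rule_format, OF that] .
qed

lemma ex_separating: obtains U where "separating U"
proof -
  obtain U :: "nat \<Rightarrow> 'a set" where U: "\<And>i. openin T (U i)"
    "\<And>V x. openin T V \<Longrightarrow> x \<in> V \<Longrightarrow> \<exists>i. x \<in> U i \<and> U i \<subseteq> V"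
    using countable_base by blast
  have op: "openin T (V - A)" if V: "openin T V" and A: "finite A" for V A
  proof -
    have "closedin T (A \<inter> topspace T)"
      using A Hausdorff_T by (intro closedin_Hausdorff_finite) auto
    then have "openin T (V - A \<inter> topspace T)" using V by blast
    moreover have "V - A \<inter> topspace T = V - A" using openin_subset[OF V] by blast
    ultimately show ?thesis by simp
  qed
  have 1: "\<exists>i. x \<in> U i \<and> U i \<inter> A = {}" if x: "x \<in> space M" "x \<notin> A" and A: "finite A" for x A
  proof -
    have "openin T (topspace T - A)" "x \<in> topspace T - A"
      using op[OF openin_topspace A] x by (simp_all add: topspace_T)
    from U(2)[OF this] obtain i where "x \<in> U i" "U i \<subseteq> topspace T - A" by blast
    then show ?thesis by blast
  qed
  have 2: "\<exists>i j. x \<in> U i \<and> U i \<inter> A = {} \<and> y \<in> U j \<and> U i \<inter> U j = {}"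
    if x: "x \<in> space M" "x \<notin> A" "y \<in> space M" "x \<noteq> y" and A: "finite A" for x y A
  proof -
    have "\<exists>V W. openin T V \<and> openin T W \<and> x \<in> V \<and> y \<in> W \<and> V \<inter> W = {}"
      using Hausdorff_T[unfolded Hausdorff_space_def topspace_T disjnt_def, rule_format, of x y] x(1,3,4)
      by simp
    then obtain V W where V: "openin T V" "openin T W" "x \<in> V" "y \<in> W" "V \<inter> W = {}" by blast
    have "x \<in> V - A" using V(3) x(2) by simp
    from U(2)[OF op[OF V(1) A] this] obtain i where i: "x \<in> U i" "U i \<subseteq> V - A" by blast
    from U(2)[OF V(2,4)] obtain j where j: "y \<in> U j" "U j \<subseteq> W" by blast
    have "U i \<inter> A = {}" "U i \<inter> U j = {}" using i j V(5) by auto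
    then show ?thesis using i j by blast
  qed
  have "separating U"
    unfolding separating_def using U(1) openin_sets 1 2 by simp
  then show ?thesis by (rule that)
qed

lemma off_diagonal_sets: "{(x, y). x \<in> space M \<and> y \<in> space M \<and> x \<noteq> y} \<in> sets (M \<Otimes>\<^sub>M M)"
proof -
  obtain U where sepU: "separating U" by (rule ex_separating)
  note U = separatingD(1,3)[OF sepU]
  have "(\<Union>i. \<Union>j. if U i \<inter> U j = {} then U i \<times> U j else {}) \<in> sets (M \<Otimes>\<^sub>M M)"
    using U(1) by auto
  also have "(\<Union>i. \<Union>j. if U i \<inter> U j = {} then U i \<times> U j else {}) =
      {(x, y). x \<in> space M \<and> y \<in> space M \<and> x \<noteq> y}" (is "?l = ?r")
  proof (intro equalityI subsetI)
    fix z assume "z \<in> ?l"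
    then obtain i j where "U i \<inter> U j = {}" "z \<in> U i \<times> U j" by (auto split: if_splits)
    then show "z \<in> ?r" using sets.sets_into_space[OF U(1)[of i]] sets.sets_into_space[OF U(1)[of j]] by auto
  next
    fix z assume "z \<in> ?r"
    then obtain x y where z: "z = (x, y)" "x \<in> space M" "y \<in> space M" "x \<noteq> y" by auto
    obtain i j where "x \<in> U i" "y \<in> U j" "U i \<inter> U j = {}" using U(2)[OF z(2,3,4), of "{}"] by auto
    then have "z \<in> (if U i \<inter> U j = {} then U i \<times> U j else {})" using z(1) by simp
    then show "z \<in> ?l" by blast
  qed
  finally show ?thesis .
qed

lemma Diff_Id_sets: "G \<in> sets (M \<Otimes>\<^sub>M M) \<Longrightarrow> G - Id \<in> sets (M \<Otimes>\<^sub>M M)"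
proof -
  assume G: "G \<in> sets (M \<Otimes>\<^sub>M M)"
  have "G - Id = G \<inter> {(x, y). x \<in> space M \<and> y \<in> space M \<and> x \<noteq> y}"
    using pair_sets_subset[OF G] by auto
  then show ?thesis using G off_diagonal_sets by simp
qed

end

context invariant_equiv begin

text \<open>Each point of the second coordinate is used at most once, so transporting one unit of mass from \<open>x\<close>
  to each point of its section delivers at most mass 1 to every point. To make this precise, \<open>G\<close> is
  cut into countably many partial isomorphisms with pairwise disjoint ranges.\<close>

lemma nn_integral_section_count_le_1:
  assumes G: "G \<in> sets (M \<Otimes>\<^sub>M M)" "G \<subseteq> R" "G \<inter> Id = {}" "single_valued (G\<inverse>)"
    and fin: "\<And>x. finite (G `` {x})"
  obtains g :: "'a \<Rightarrow> ennreal" where "g \<in> borel_measurable (completion M)"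
    "(\<integral>\<^sup>+x. g x \<partial>completion M) \<le> 1" "AE x in M. g x = emeasure (count_space UNIV) (G `` {x})"
proof -
  obtain U where sepU: "separating U" by (rule ex_separating)
  note U = separatingD(1)[OF sepU] and sep = separatingD(3)[OF sepU]
  have Gsp: "G \<subseteq> space M \<times> space M" by (rule pair_sets_subset[OF G(1)])
  have rect: "G \<inter> A \<times> B \<in> sets (M \<Otimes>\<^sub>M M)" if "A \<in> sets M" "B \<in> sets M" for A B
    using G(1) that by auto
  define W where "W B = Domain (G \<inter> space M \<times> B)" for B
  have W: "W B \<in> sets (completion M)" if "B \<in> sets M" for B
    unfolding W_def using rect[OF _ that] by (intro Domain_completion_sets) auto
  \<comment> \<open>\<open>B i\<close> consists of the points whose section has exactly one point in \<open>U i\<close>; \<open>B' i\<close> is a Borel set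
    inside it that differs by a null set.\<close>
  define B where "B i = W (U i) - (\<Union>k. \<Union>l. if U k \<inter> U l = {} then W (U i \<inter> U k) \<inter> W (U i \<inter> U l) else {})" for i
  have "B i \<in> sets (completion M)" for i
    unfolding B_def using W U by auto
  then have "\<exists>B'. B' \<in> sets M \<and> B' \<subseteq> B i \<and> (AE x in M. x \<in> B i \<longrightarrow> x \<in> B')" for i
    by (metis completion_inner[of "B i"])
  then obtain B' where B': "\<And>i. B' i \<in> sets M" "\<And>i. B' i \<subseteq> B i" "\<And>i. AE x in M. x \<in> B i \<longrightarrow> x \<in> B' i"
    by metis
  have B_single: "y = z" if hyp: "x \<in> B i" "(x, y) \<in> G" "(x, z) \<in> G" "y \<in> U i" "z \<in> U i" for x y z i
  proof (rule ccontr)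
    assume "y \<noteq> z"
    then obtain k l where kl: "y \<in> U k" "z \<in> U l" "U k \<inter> U l = {}"
      using sep[of y z "{}"] hyp(2,3) Gsp by auto
    have "x \<in> space M" using hyp(2) Gsp by blast
    then have "x \<in> W (U i \<inter> U k)" "x \<in> W (U i \<inter> U l)"
      unfolding W_def using hyp kl(1,2) by blast+
    then have "x \<in> (if U k \<inter> U l = {} then W (U i \<inter> U k) \<inter> W (U i \<inter> U l) else {})" using kl(3) by simp
    then show False using hyp(1) unfolding B_def by blast
  qed
  \<comment> \<open>The sets \<open>H n\<close> cover \<open>G\<close> up to a null set of first coordinates: isolate \<open>y\<close> in the section of \<open>x\<close>
    by \<open>U i\<close> and put \<open>x\<close> into a disjoint \<open>U j\<close>. Disjointness makes domain and range disjoint, as the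
    extension to an involution requires.\<close>
  define H where "H n = (case prod_decode n of (i, j) \<Rightarrow>
    if U i \<inter> U j = {} then G \<inter> (B' i \<inter> U j) \<times> U i else {})" for n
  have H_sets: "H n \<in> sets (M \<Otimes>\<^sub>M M)" for n
    unfolding H_def using rect B'(1) U by (auto split: prod.split)
  have H_sv: "single_valued (H n)" and H_disj: "Domain (H n) \<inter> Range (H n) = {}" for n
  proof -
    obtain i j where ij: "prod_decode n = (i, j)" by (cases "prod_decode n")
    show "single_valued (H n)"
      using B_single B'(2)[of i] unfolding single_valued_def H_def ij by (auto split: if_splits)
    show "Domain (H n) \<inter> Range (H n) = {}" unfolding H_def ij by (auto split: if_splits)
  qed
  have HG: "H n \<subseteq> G" for n unfolding H_def by (auto split: prod.split)
  define K where "K = disjointed H"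
  have K_sets: "K n \<in> sets (M \<Otimes>\<^sub>M M)" for n
    using sets.range_disjointed_sets[of H "M \<Otimes>\<^sub>M M"] H_sets unfolding K_def by auto
  have KH: "K n \<subseteq> H n" for n unfolding K_def by (rule disjointed_subset)
  have KG: "K n \<subseteq> G" for n using KH HG by blast
  have K_disj: "disjoint_family K" unfolding K_def by (rule disjoint_family_disjointed)
  have K_sv: "single_valued (K n)" for n using H_sv KH single_valued_subset by blast
  have K_Un: "(\<Union>n. K n) = (\<Union>n. H n)" unfolding K_def by (rule UN_disjointed_eq)
  define g where "g x = (\<Sum>n. indicator (Domain (K n)) x :: ennreal)" for x
  have Dom: "Domain (K n) \<in> sets (completion M)" for n using Domain_completion_sets[OF K_sets] .
  have g_meas: "g \<in> borel_measurable (completion M)"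
    unfolding g_def using Dom by measurable
  have "disjoint_family (\<lambda>n. Range (K n))"
    unfolding disjoint_family_on_def
  proof (intro ballI impI, rule ccontr)
    fix m n assume "m \<noteq> n" "Range (K m) \<inter> Range (K n) \<noteq> {}"
    then obtain x x' y where xy: "(x, y) \<in> K m" "(x', y) \<in> K n" by auto
    then have "x = x'" using KG G(4) unfolding single_valued_def by blast
    then show False using xy K_disj \<open>m \<noteq> n\<close> unfolding disjoint_family_on_def by blast
  qed
  then have "(\<Sum>n. emeasure (completion M) (Range (K n))) = emeasure (completion M) (\<Union>n. Range (K n))"
    using Range_completion_sets[OF K_sets] by (intro suminf_emeasure) auto
  also have "\<dots> \<le> emeasure (completion M) (space (completion M))" by (rule emeasure_space)
  also have "\<dots> = 1" by (simp add: emeasure_space_1)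
  finally have sum_Range: "(\<Sum>n. emeasure (completion M) (Range (K n))) \<le> 1" .
  have "(\<integral>\<^sup>+x. g x \<partial>completion M) = (\<Sum>n. \<integral>\<^sup>+x. indicator (Domain (K n)) x \<partial>completion M)"
    unfolding g_def using Dom by (intro nn_integral_suminf) auto
  also have "\<dots> = (\<Sum>n. emeasure (completion M) (Domain (K n)))"
    using Dom by (simp del: emeasure_completion)
  also have "\<dots> \<le> (\<Sum>n. emeasure (completion M) (Range (K n)))"
  proof (intro suminf_le emeasure_Domain_le_Range)
    fix n
    show "K n \<in> sets (M \<Otimes>\<^sub>M M)" "single_valued (K n)" by (fact K_sets, fact K_sv)
    show "single_valued ((K n)\<inverse>)" using KG[of n] G(4) by (meson converse_mono single_valued_subset)
    show "K n \<subseteq> R" using KG G(2) by blast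
    show "Domain (K n) \<inter> Range (K n) = {}" using H_disj[of n] KH[of n] by blast
  qed auto
  finally have g_int: "(\<integral>\<^sup>+x. g x \<partial>completion M) \<le> 1" using sum_Range by (rule order_trans)
  have "AE x in M. \<forall>i. x \<in> B i \<longrightarrow> x \<in> B' i" using B'(3) by (simp add: AE_all_countable)
  then have "AE x in M. g x = emeasure (count_space UNIV) (G `` {x})"
  proof eventually_elim
    case (elim x)
    have cover: "\<exists>n. (x, y) \<in> K n" if xy: "(x, y) \<in> G" for y
    proof -
      have "y \<noteq> x" "x \<in> space M" "y \<in> space M" using xy G(3) Gsp by auto
      then obtain i j where ij: "y \<in> U i" "U i \<inter> (G `` {x} - {y}) = {}" "x \<in> U j" "U i \<inter> U j = {}"
        using sep[of y x "G `` {x} - {y}"] fin[of x] by auto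
      have "x \<in> W (U i)" unfolding W_def using xy ij(1) \<open>x \<in> space M\<close> by blast
      moreover have "x \<notin> W (U i \<inter> U k) \<inter> W (U i \<inter> U l)" if "U k \<inter> U l = {}" for k l
      proof
        assume "x \<in> W (U i \<inter> U k) \<inter> W (U i \<inter> U l)"
        then obtain z z' where "(x, z) \<in> G" "z \<in> U i" "z \<in> U k" "(x, z') \<in> G" "z' \<in> U i" "z' \<in> U l"
          unfolding W_def by blast
        moreover from this have "z = y" "z' = y" using ij(2) by auto
        ultimately show False using that by auto
      qed
      ultimately have "x \<in> B i" unfolding B_def by (auto split: if_splits)
      then have "x \<in> B' i" using elim by blast
      then have "(x, y) \<in> H (prod_encode (i, j))" unfolding H_def using xy ij by simp
      then show ?thesis using K_Un by blast
    qed
    have "indicator (Domain (K n)) x = emeasure (count_space UNIV) (K n `` {x})" for n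
    proof (cases "x \<in> Domain (K n)")
      case True
      then obtain y where "(x, y) \<in> K n" by blast
      then have "K n `` {x} = {y}" using K_sv[of n] unfolding single_valued_def by blast
      then show ?thesis using True by simp
    next
      case False
      then have "K n `` {x} = {}" by blast
      then show ?thesis using False by simp
    qed
    then have "g x = (\<Sum>n. emeasure (count_space UNIV) (K n `` {x}))" by (simp add: g_def)
    also have "\<dots> = emeasure (count_space UNIV) (\<Union>n. K n `` {x})"
      using K_disj by (intro suminf_emeasure) (auto simp: disjoint_family_on_def)
    also have "(\<Union>n. K n `` {x}) = G `` {x}" using cover KG by blast
    finally show ?case .
  qed
  with g_meas g_int show ?thesis by (rule that)
qed

text \<open>The classes of different points of \<open>D\<close> are disjoint, so by the previous lemma the classes of the
  finite approximations, restricted to \<open>D\<close> in the first coordinate, have total size at most 1. As the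
  approximations grow, these sizes increase to infinity at almost every point of \<open>D\<close>.\<close>

lemma transversal_null:
  assumes E: "borel_equiv M E" "E \<subseteq> R" "hyperfinite M E" "aperiodic M E"
    and D: "D \<in> sets M" "E \<inter> D \<times> D \<subseteq> Id"
  shows "AE x in M. x \<notin> D"
proof -
  obtain F :: "nat \<Rightarrow> ('a \<times> 'a) set" where F: "\<And>n. borel_equiv M (F n)" "\<And>n. F n \<subseteq> E"
    and fin: "\<And>n x. x \<in> space M \<Longrightarrow> finite (F n `` {x})" and inc: "\<And>n. F n \<subseteq> F (Suc n)"
    and AE: "AE x in M. \<forall>y. (x, y) \<in> E \<longrightarrow> (\<exists>n. (x, y) \<in> F n)"
    using E(1,3) by (rule hyperfiniteE) blast
  define G where "G n = F n \<inter> D \<times> space M - Id" for n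
  have "\<exists>g. g \<in> borel_measurable (completion M) \<and> (\<integral>\<^sup>+x. g x \<partial>completion M) \<le> 1 \<and>
      (AE x in M. g x = emeasure (count_space UNIV) (G n `` {x}))" for n
  proof -
    have "F n \<inter> D \<times> space M \<in> sets (M \<Otimes>\<^sub>M M)" using borel_equivD(1)[OF F(1)] D(1) by auto
    then have G: "G n \<in> sets (M \<Otimes>\<^sub>M M)" unfolding G_def by (rule Diff_Id_sets)
    have GR: "G n \<subseteq> R" "G n \<inter> Id = {}" using F(2)[of n] E(2) by (auto simp: G_def)
    have sv: "single_valued ((G n)\<inverse>)"
      unfolding single_valued_def
    proof (intro allI impI)
      fix y x x' assume "(y, x) \<in> (G n)\<inverse>" "(y, x') \<in> (G n)\<inverse>"
      then have "(x, y) \<in> E" "(x', y) \<in> E" "x \<in> D" "x' \<in> D" using F(2) by (auto simp: G_def)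
      then show "x = x'" using borel_equivD(7,8)[OF E(1)] D(2) by blast
    qed
    have finG: "finite (G n `` {x})" for x
    proof (cases "x \<in> space M")
      case True
      have "G n `` {x} \<subseteq> F n `` {x}" by (auto simp: G_def)
      then show ?thesis using fin[OF True] by (rule finite_subset)
    next
      case False
      then have "G n `` {x} = {}" using pair_sets_subset[OF G] by auto
      then show ?thesis by simp
    qed
    obtain g where "g \<in> borel_measurable (completion M)" "(\<integral>\<^sup>+x. g x \<partial>completion M) \<le> 1"
      "AE x in M. g x = emeasure (count_space UNIV) (G n `` {x})"
      by (rule nn_integral_section_count_le_1[OF G GR sv finG])
    then show ?thesis by (intro exI[of _ g] conjI)
  qed
  then obtain g where g: "\<And>n. g n \<in> borel_measurable (completion M)"
    "\<And>n. (\<integral>\<^sup>+x. g n x \<partial>completion M) \<le> 1"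
    "\<And>n. AE x in M. g n x = emeasure (count_space UNIV) (G n `` {x})" by metis
  have Ginc: "G n `` {x} \<subseteq> G (Suc n) `` {x}" for n x using inc[of n] by (auto simp: G_def)
  have "AE x in completion M. g n x \<le> g (Suc n) x" for n
  proof -
    have "AE x in M. g n x \<le> g (Suc n) x"
      using g(3)[of n] g(3)[of "Suc n"]
    proof eventually_elim
      case (elim x)
      then show ?case using Ginc[of n x] by (auto intro: emeasure_mono)
    qed
    then show ?thesis by (rule AE_completion)
  qed
  then have "(\<integral>\<^sup>+x. (SUP n. g n x) \<partial>completion M) = (SUP n. \<integral>\<^sup>+x. g n x \<partial>completion M)"
    using g(1) by (intro nn_integral_monotone_convergence_SUP_AE) auto
  also have "\<dots> \<le> 1" using g(2) by (intro SUP_least)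
  finally have "(\<integral>\<^sup>+x. (SUP n. g n x) \<partial>completion M) \<noteq> \<infinity>" by (auto simp: top_unique)
  then have "AE x in completion M. (SUP n. g n x) \<noteq> \<infinity>"
    using g(1) by (intro nn_integral_noteq_infinite) auto
  then have "AE x in M. (SUP n. g n x) \<noteq> \<infinity>" by (simp add: AE_completion_iff)
  moreover have "AE x in M. \<forall>n. g n x = emeasure (count_space UNIV) (G n `` {x})"
    using g(3) by (simp add: AE_all_countable)
  moreover have "AE x in M. infinite (E `` {x})" using E(4) by (simp add: aperiodic_def)
  ultimately show ?thesis using AE
  proof eventually_elim
    case (elim x)
    show ?case
    proof
      assume x: "x \<in> D"
      have "(\<Union>n. G n `` {x}) = E `` {x} - {x}"
      proof (intro equalityI subsetI)
        fix y assume "y \<in> (\<Union>n. G n `` {x})"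
        then show "y \<in> E `` {x} - {x}" using F(2) unfolding G_def by blast
      next
        fix y assume y: "y \<in> E `` {x} - {x}"
        then obtain n where "(x, y) \<in> F n" using elim(4) by blast
        moreover have "y \<in> space M" using y borel_equivD(6)[OF E(1), of x y] by simp
        ultimately have "(x, y) \<in> G n" using x y unfolding G_def by auto
        then show "y \<in> (\<Union>n. G n `` {x})" by blast
      qed
      then have "infinite (\<Union>n. G n `` {x})" using elim(3) by simp
      then have "\<infinity> = emeasure (count_space UNIV) (\<Union>n. G n `` {x})" by simp
      also have "\<dots> = (SUP n. emeasure (count_space UNIV) (G n `` {x}))"
        using Ginc by (intro SUP_emeasure_incseq[symmetric]) (auto simp: incseq_Suc_iff)
      also have "\<dots> = (SUP n. g n x)" using elim(2) by simp
      finally show False using elim(1) by simp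
    qed
  qed
qed

text \<open>Poincare recurrence. If the class of \<open>x \<in> A\<close> meets \<open>A\<close> in a finite set only, then some member \<open>U i\<close> of
  a separating family meets this finite set in \<open>x\<close> alone. The points isolated in this way by the same
  \<open>U i\<close> form a transversal, which is null.\<close>

theorem recurrence:
  assumes E: "borel_equiv M E" "E \<subseteq> R" "hyperfinite M E" "aperiodic M E"
    and A: "A \<in> sets M"
  shows "AE x in M. x \<in> A \<longrightarrow> infinite (E `` {x} \<inter> A)"
proof -
  obtain U where sepU: "separating U" by (rule ex_separating)
  note U = separatingD(1)[OF sepU] and sep = separatingD(2)[OF sepU]
  define D where "D i = A \<inter> U i - Domain (E \<inter> (A \<inter> U i) \<times> (A \<inter> U i) - Id)" for i
  have "AE x in M. x \<notin> D i" for i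
  proof -
    have "E \<inter> (A \<inter> U i) \<times> (A \<inter> U i) \<in> sets (M \<Otimes>\<^sub>M M)" using borel_equivD(1)[OF E(1)] A U by auto
    then have "Domain (E \<inter> (A \<inter> U i) \<times> (A \<inter> U i) - Id) \<in> sets (completion M)"
      by (intro Domain_completion_sets Diff_Id_sets)
    then have "D i \<in> sets (completion M)" unfolding D_def using A U by auto
    then obtain B where B: "B \<in> sets M" "B \<subseteq> D i" "AE x in M. x \<in> D i \<longrightarrow> x \<in> B"
      by (rule completion_inner)
    have "E \<inter> B \<times> B \<subseteq> Id" using B(2) unfolding D_def by blast
    from transversal_null[OF E B(1) this] B(3) show ?thesis by eventually_elim blast
  qed
  then have "AE x in M. \<forall>i. x \<notin> D i" by (simp add: AE_all_countable)
  moreover have "AE x in M. x \<in> space M" by (rule AE_space)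
  ultimately show ?thesis
  proof eventually_elim
    case (elim x)
    show ?case
    proof (intro impI notI)
      assume x: "x \<in> A" and fin: "finite (E `` {x} \<inter> A)"
      obtain i where i: "x \<in> U i" "U i \<inter> (E `` {x} \<inter> A - {x}) = {}"
        using sep[OF elim(2), of "E `` {x} \<inter> A - {x}"] fin by auto
      then have "x \<in> D i" unfolding D_def using x by blast
      then show False using elim(1) by blast
    qed
  qed
qed

section \<open>Quasi-normalizing maps\<close>

lemma full_group_inverse:
  assumes \<phi>: "\<phi> \<in> carrier (borel_full_group M R)"
  shows "restrict (inv_into (space M) \<phi>) (space M) \<in> carrier (borel_full_group M R)" (is "?\<psi> \<in> _")
proof -
  let ?S = "space M"
  have bij: "bij_betw \<phi> ?S ?S" by (rule full_groupD(1)[OF \<phi>])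
  have Bij: "\<phi> \<in> Bij ?S" using \<phi> by (simp add: borel_full_group_def)
  have \<psi>: "?\<psi> \<in> Bij ?S" using Bij by (rule restrict_inv_into_Bij)
  have sp: "inv_into ?S \<phi> x \<in> ?S" and r: "\<phi> (inv_into ?S \<phi> x) = x" if "x \<in> ?S" for x
    using bij_betw_inv_into_right[OF bij that] Bij_inv_into_mem[OF Bij that] by auto
  have "?\<psi> \<in> measurable M M"
    using full_groupD(4)[OF \<phi>] measurable_cong[of M ?\<psi> "inv_into ?S \<phi>" M] by simp
  moreover have "inv_into ?S ?\<psi> x = \<phi> x" if x: "x \<in> ?S" for x
  proof (rule inv_into_f_eq)
    show "inj_on ?\<psi> ?S" using \<psi> by (simp add: Bij_def bij_betw_def)
    show "\<phi> x \<in> ?S" using full_groupD(6)[OF \<phi> x] .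
    then show "?\<psi> (\<phi> x) = x" using bij_betw_inv_into_left[OF bij x] by simp
  qed
  then have "inv_into ?S ?\<psi> \<in> measurable M M"
    using full_groupD(3)[OF \<phi>] measurable_cong[of M "inv_into ?S ?\<psi>" \<phi> M] by simp
  moreover have "(x, ?\<psi> x) \<in> R" if x: "x \<in> ?S" for x
    using full_groupD(5)[OF \<phi> sp[OF x]] borel_equivD(7)[OF R] r[OF x] x by simp
  ultimately show ?thesis using \<psi> by (simp add: borel_full_group_def)
qed

lemma full_group_AE_inv:
  assumes "\<phi> \<in> carrier (borel_full_group M R)" "AE x in M. P x"
  shows "AE x in M. P (inv_into (space M) \<phi> x)"
proof -
  have "AE x in M. P (restrict (inv_into (space M) \<phi>) (space M) x)"
    by (rule full_group_AE[OF full_group_inverse[OF assms(1)] assms(2)])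
  with AE_space show ?thesis by eventually_elim simp
qed

text \<open>A maximal hyperfinite relation over \<open>E\<close> and the relation \<open>Tm\<close> are both maximal hyperfinite over
  \<open>B\<close>, hence equal up to null sets.\<close>

lemma rank_one_absorb:
  assumes r1: "rank_one M R" and Tm: "maximal_hyperfinite M R Tm"
    and B: "subequiv M R B" "aperiodic M B" "hyperfinite M B" "ae_subset M B Tm"
    and E: "subequiv M R E" "hyperfinite M E" "B \<subseteq> E"
  shows "ae_subset M E Tm"
proof -
  have max_sets: "X \<in> sets (M \<Otimes>\<^sub>M M)" if "maximal_hyperfinite M R X" for X
    using that subequivD(3) unfolding maximal_hyperfinite_def by blast
  have apE: "aperiodic M E"
    using B(2) unfolding aperiodic_def
  proof eventually_elim
    case (elim x)
    have "B `` {x} \<subseteq> E `` {x}" using E(3) by blast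
    with elim show ?case using finite_subset by blast
  qed
  obtain E' where E': "maximal_hyperfinite M R E'" "ae_subset M E E'"
    using r1 E(1,2) apE unfolding rank_one_def by blast
  obtain B' where B': "\<And>X. maximal_hyperfinite M R X \<Longrightarrow> ae_subset M B X \<Longrightarrow> ae_eq M X B'"
      and B'_max: "maximal_hyperfinite M R B'"
    using r1 B(1-3) unfolding rank_one_def by blast
  have EE': "AE x in M. \<forall>y. (x, y) \<in> E \<longrightarrow> (x, y) \<in> E'"
    using E'(2) unfolding ae_subset_iff[OF subequivD(3)[OF E(1)] max_sets[OF E'(1)]] .
  then have "AE x in M. \<forall>y. (x, y) \<in> B \<longrightarrow> (x, y) \<in> E'"
    by eventually_elim (use E(3) in blast)
  then have "ae_subset M B E'"
    unfolding ae_subset_iff[OF subequivD(3)[OF B(1)] max_sets[OF E'(1)]] .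
  then have "ae_eq M E' B'" using B' E'(1) by blast
  moreover have "ae_eq M Tm B'" using B' Tm B(4) by blast
  ultimately have "AE x in M. \<forall>y. (x, y) \<in> E' \<longleftrightarrow> (x, y) \<in> B'" "AE x in M. \<forall>y. (x, y) \<in> Tm \<longleftrightarrow> (x, y) \<in> B'"
    using ae_eq_iff[OF max_sets max_sets] E'(1) Tm B'_max by blast+
  with EE' have "AE x in M. \<forall>y. (x, y) \<in> E \<longrightarrow> (x, y) \<in> Tm" by eventually_elim blast
  then show ?thesis unfolding ae_subset_iff[OF subequivD(3)[OF E(1)] max_sets[OF Tm]] .
qed

text \<open>The pullback of \<open>E\<close> along \<open>p\<close>, cut along the boundary of \<open>C\<close>. Below, \<open>p\<close> folds one half of \<open>C\<close> onto the
  other half and fixes all other points.\<close>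

definition folded :: "('a \<Rightarrow> 'a) \<Rightarrow> 'a set \<Rightarrow> ('a \<times> 'a) set \<Rightarrow> ('a \<times> 'a) set" where
  "folded p C E = {(x, y). x \<in> space M \<and> y \<in> space M \<and> (x \<in> C \<longleftrightarrow> y \<in> C) \<and> (p x, p y) \<in> E}"

lemma borel_equiv_folded:
  assumes E: "borel_equiv M E" and p: "p \<in> measurable M M" and C: "C \<in> sets M"
  shows "borel_equiv M (folded p C E)"
proof (rule borel_equivI)
  have "(\<lambda>z. (p (fst z), p (snd z))) -` E \<inter> space (M \<Otimes>\<^sub>M M) \<in> sets (M \<Otimes>\<^sub>M M)"
    using p borel_equivD(1)[OF E] by (intro measurable_sets[of _ _ "M \<Otimes>\<^sub>M M"]) auto
  moreover have "C \<times> C \<union> (space M - C) \<times> (space M - C) \<in> sets (M \<Otimes>\<^sub>M M)"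
    using C by (intro sets.Un pair_measureI) auto
  ultimately have "((\<lambda>z. (p (fst z), p (snd z))) -` E \<inter> space (M \<Otimes>\<^sub>M M)) \<inter>
      (C \<times> C \<union> (space M - C) \<times> (space M - C)) \<in> sets (M \<Otimes>\<^sub>M M)"
    by (rule sets.Int)
  also have "((\<lambda>z. (p (fst z), p (snd z))) -` E \<inter> space (M \<Otimes>\<^sub>M M)) \<inter>
      (C \<times> C \<union> (space M - C) \<times> (space M - C)) = folded p C E"
    using sets.sets_into_space[OF C] by (auto simp: folded_def space_pair_measure)
  finally show "folded p C E \<in> sets (M \<Otimes>\<^sub>M M)" .
next
  fix x assume "x \<in> space M"
  then show "(x, x) \<in> folded p C E"
    using borel_equivD(5)[OF E] measurable_space[OF p] by (simp add: folded_def)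
next
  fix x y assume "(x, y) \<in> folded p C E"
  then show "(y, x) \<in> folded p C E" using borel_equivD(7)[OF E] by (simp add: folded_def)
next
  fix x y z assume "(x, y) \<in> folded p C E" "(y, z) \<in> folded p C E"
  then show "(x, z) \<in> folded p C E"
    using borel_equivD(8)[OF E, of "p x" "p y" "p z"] by (simp add: folded_def)
qed

text \<open>\<open>E\<close> is the part of \<open>S\<close> that \<open>\<phi>\<close> maps into \<open>S\<close>. Its classes are mapped bijectively to those of
  \<open>push_rel \<phi> S \<inter> S\<close>, hence are infinite.\<close>

lemma common_subrelation:
  assumes S: "subequiv M R S" "hyperfinite M S" and \<phi>: "\<phi> \<in> carrier (borel_full_group M R)"
    and ap: "aperiodic M (push_rel \<phi> S \<inter> S)"
  defines "E \<equiv> {(x, y) \<in> S. (\<phi> x, \<phi> y) \<in> S}"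
  shows "borel_equiv M E" "hyperfinite M E" "aperiodic M E"
proof -
  have bS: "borel_equiv M S" by (rule subequivD(1)[OF S(1)])
  note \<phi>m = full_groupD(3)[OF \<phi>] and \<phi>s = full_groupD(6)[OF \<phi>]
  show bE: "borel_equiv M E"
  proof (rule borel_equivI)
    have "(\<lambda>z. (\<phi> (fst z), \<phi> (snd z))) -` S \<inter> space (M \<Otimes>\<^sub>M M) \<in> sets (M \<Otimes>\<^sub>M M)"
      using \<phi>m borel_equivD(1)[OF bS] by (intro measurable_sets[of _ _ "M \<Otimes>\<^sub>M M"]) auto
    with borel_equivD(1)[OF bS] have "S \<inter> ((\<lambda>z. (\<phi> (fst z), \<phi> (snd z))) -` S \<inter> space (M \<Otimes>\<^sub>M M)) \<in> sets (M \<Otimes>\<^sub>M M)"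
      by (rule sets.Int)
    also have "S \<inter> ((\<lambda>z. (\<phi> (fst z), \<phi> (snd z))) -` S \<inter> space (M \<Otimes>\<^sub>M M)) = E"
      using pair_sets_subset[OF borel_equivD(1)[OF bS]] by (auto simp: E_def space_pair_measure)
    finally show "E \<in> sets (M \<Otimes>\<^sub>M M)" .
  next
    fix x assume "x \<in> space M"
    then show "(x, x) \<in> E" using borel_equivD(5)[OF bS] \<phi>s by (simp add: E_def)
  next
    fix x y assume "(x, y) \<in> E"
    then show "(y, x) \<in> E" using borel_equivD(7)[OF bS] by (simp add: E_def)
  next
    fix x y z assume "(x, y) \<in> E" "(y, z) \<in> E"
    then show "(x, z) \<in> E"
      using borel_equivD(8)[OF bS, of x y z] borel_equivD(8)[OF bS, of "\<phi> x" "\<phi> y" "\<phi> z"]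
      by (simp add: E_def)
  qed
  have "AE x in M. \<forall>y. (x, y) \<in> E \<longrightarrow> (x, y) \<in> S" by (simp add: E_def)
  then have "ae_subset M E S" unfolding ae_subset_iff[OF borel_equivD(1)[OF bE] borel_equivD(1)[OF bS]] .
  with bS S(2) bE show "hyperfinite M E" by (rule hyperfinite_ae_subset)
  have "AE x in M. infinite ((push_rel \<phi> S \<inter> S) `` {\<phi> x})"
    using full_group_AE[OF \<phi> ap[unfolded aperiodic_def]] .
  with AE_space show "aperiodic M E"
    unfolding aperiodic_def
  proof eventually_elim
    case (elim x)
    have "(push_rel \<phi> S \<inter> S) `` {\<phi> x} \<subseteq> \<phi> ` (E `` {x})"
    proof
      fix y assume "y \<in> (push_rel \<phi> S \<inter> S) `` {\<phi> x}"
      then obtain a b where ab: "\<phi> x = \<phi> a" "y = \<phi> b" "(a, b) \<in> S" "(\<phi> x, y) \<in> S"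
        unfolding push_rel_def by auto
      have "a \<in> space M" using borel_equivD(6)[OF bS ab(3)] by simp
      then have "x = a" using full_groupD(1)[OF \<phi>] elim(1) ab(1) unfolding bij_betw_def inj_on_def by blast
      then show "y \<in> \<phi> ` (E `` {x})" using ab by (auto simp: E_def)
    qed
    then show "infinite (E `` {x})" using elim(2) finite_subset by blast
  qed
qed

text \<open>Let \<open>A'\<close> be the image of \<open>A\<close>, which is disjoint from \<open>A\<close>, and let \<open>p\<close> fold \<open>A'\<close> back onto \<open>A\<close> by the
  inverse of \<open>\<phi>\<close>. Folding is at most two-to-one, so the pullback \<open>F\<close> of \<open>E\<close> inherits finite
  approximations from \<open>E\<close>; and it relates \<open>x\<close> to \<open>\<phi> x\<close> for \<open>x \<in> A\<close>. The part of \<open>F\<close> inside \<open>S\<close> is still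
  aperiodic: it contains the restrictions of \<open>E\<close> to \<open>A\<close> and to the complement of \<open>A \<union> A'\<close>, and on
  \<open>A'\<close> the image under \<open>\<phi>\<close> of the restriction to \<open>A\<close>. By recurrence all classes of these are infinite. So \<open>F\<close> is absorbed by the
  maximal relation.\<close>

lemma quasi_normalizing_on_displaced_set:
  assumes r1: "rank_one M R" and Tm: "maximal_hyperfinite M R Tm"
    and S: "subequiv M R S" "hyperfinite M S" "ae_subset M S Tm"
    and \<phi>: "\<phi> \<in> carrier (borel_full_group M R)" and ap: "aperiodic M (push_rel \<phi> S \<inter> S)"
    and A: "A \<in> sets M" "\<And>x. x \<in> A \<Longrightarrow> \<phi> x \<notin> A"
  shows "AE x in M. x \<in> A \<longrightarrow> (x, \<phi> x) \<in> Tm"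
proof -
  define E where "E = {(x, y) \<in> S. (\<phi> x, \<phi> y) \<in> S}"
  note E = common_subrelation[OF S(1,2) \<phi> ap, folded E_def]
  have bS: "borel_equiv M S" by (rule subequivD(1)[OF S(1)])
  have SR: "S \<subseteq> R" by (rule subequivD(2)[OF S(1)])
  have ES: "E \<subseteq> S" by (auto simp: E_def)
  have ER: "E \<subseteq> R" using ES SR by blast
  note \<phi>s = full_groupD(6)[OF \<phi>]
  define \<psi> where "\<psi> = inv_into (space M) \<phi>"
  have \<psi>m: "\<psi> \<in> measurable M M" unfolding \<psi>_def by (rule full_groupD(4)[OF \<phi>])
  have \<psi>s: "\<psi> x \<in> space M" if "x \<in> space M" for x using measurable_space[OF \<psi>m that] .
  have \<phi>\<psi>: "\<phi> (\<psi> x) = x" and \<psi>\<phi>: "\<psi> (\<phi> x) = x" if "x \<in> space M" for x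
    using full_groupD(1)[OF \<phi>] that unfolding \<psi>_def
    by (auto intro: bij_betw_inv_into_left bij_betw_inv_into_right)
  have Asp: "A \<subseteq> space M" by (rule sets.sets_into_space[OF A(1)])
  define A' where "A' = \<psi> -` A \<inter> space M"
  have A'_sets: "A' \<in> sets M" unfolding A'_def by (rule measurable_sets[OF \<psi>m A(1)])
  have A'_iff: "x \<in> A' \<longleftrightarrow> x \<in> space M \<and> \<psi> x \<in> A" for x by (auto simp: A'_def)
  have disj: "A \<inter> A' = {}"
  proof -
    have False if "x \<in> A" "x \<in> A'" for x
      using A(2)[of "\<psi> x"] \<phi>\<psi>[of x] that Asp by (auto simp: A'_iff)
    then show ?thesis by blast
  qed
  have \<phi>A': "\<phi> x \<in> A'" if "x \<in> A" for x
    using that Asp \<phi>s \<psi>\<phi> by (auto simp: A'_iff)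
  define C where "C = A \<union> A'"
  \<comment> \<open>Each fibre of \<open>p\<close> lies in a set of the form \<open>{z, \<phi> z}\<close>; this keeps the approximations of the
    pullback finite.\<close>
  define p where "p x = (if x \<in> A' then \<psi> x else x)" for x
  have C_sets: "C \<in> sets M" unfolding C_def using A(1) A'_sets by simp
  have pm: "p \<in> measurable M M"
    unfolding p_def using \<psi>m A'_sets by (intro measurable_If_set) (auto simp: sets.Int_space_eq2)
  have ps: "p x \<in> space M" if "x \<in> space M" for x by (rule measurable_space[OF pm that])
  have pR: "(x, p x) \<in> R" if "x \<in> space M" for x
  proof (cases "x \<in> A'")
    case True
    then have "(\<psi> x, x) \<in> R" using full_groupD(5)[OF \<phi> \<psi>s[OF that]] \<phi>\<psi>[OF that] by simp
    then show ?thesis using True borel_equivD(7)[OF R] by (simp add: p_def)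
  next
    case False
    then show ?thesis using borel_equivD(5)[OF R that] by (simp add: p_def)
  qed
  let ?F = "folded p C E"
  have bF: "borel_equiv M ?F" by (rule borel_equiv_folded[OF E(1) pm C_sets])
  have "?F \<subseteq> R"
  proof clarify
    fix x y assume "(x, y) \<in> ?F"
    then have xy: "x \<in> space M" "y \<in> space M" "(p x, p y) \<in> R" using ER by (auto simp: folded_def)
    have "(x, p y) \<in> R" by (rule borel_equivD(8)[OF R pR[OF xy(1)] xy(3)])
    moreover have "(p y, y) \<in> R" by (rule borel_equivD(7)[OF R pR[OF xy(2)]])
    ultimately show "(x, y) \<in> R" by (rule borel_equivD(8)[OF R])
  qed
  with bF have sF: "subequiv M R ?F" by (simp add: subequiv_def)
  have hF: "hyperfinite M ?F"
  proof -
    obtain H :: "nat \<Rightarrow> ('a \<times> 'a) set" where H: "\<And>n. borel_equiv M (H n)" "\<And>n. H n \<subseteq> E"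
      and fin: "\<And>n x. x \<in> space M \<Longrightarrow> finite (H n `` {x})" and inc: "\<And>n. H n \<subseteq> H (Suc n)"
      and AE: "AE x in M. \<forall>y. (x, y) \<in> E \<longrightarrow> (\<exists>n. (x, y) \<in> H n)"
      using E(1,2) by (rule hyperfiniteE) blast
    show ?thesis
    proof (rule hyperfiniteI[OF bF, of "\<lambda>n. folded p C (H n)"])
      fix n
      show "borel_equiv M (folded p C (H n))" by (rule borel_equiv_folded[OF H(1) pm C_sets])
      show "folded p C (H n) \<subseteq> ?F" using H(2)[of n] by (auto simp: folded_def)
      show "folded p C (H n) \<subseteq> folded p C (H (Suc n))" using inc[of n] by (auto simp: folded_def)
      show "finite (folded p C (H n) `` {x})" if x: "x \<in> space M" for x
      proof -
        let ?Z = "H n `` {p x}"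
        have "folded p C (H n) `` {x} \<subseteq> ?Z \<union> \<phi> ` ?Z"
        proof
          fix y assume "y \<in> folded p C (H n) `` {x}"
          then have y: "y \<in> space M" "p y \<in> ?Z" by (auto simp: folded_def)
          have "y = p y \<or> y = \<phi> (p y)" using \<phi>\<psi>[OF y(1)] by (simp add: p_def)
          then show "y \<in> ?Z \<union> \<phi> ` ?Z" using y(2) by (metis UnI1 UnI2 imageI)
        qed
        moreover have "finite (?Z \<union> \<phi> ` ?Z)" using fin[OF ps[OF x]] by simp
        ultimately show ?thesis by (rule finite_subset)
      qed
    next
      have "AE x in M. \<forall>y. (\<psi> x, y) \<in> E \<longrightarrow> (\<exists>n. (\<psi> x, y) \<in> H n)"
        unfolding \<psi>_def by (rule full_group_AE_inv[OF \<phi> AE])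
      with AE show "AE x in M. \<forall>y. (x, y) \<in> ?F \<longrightarrow> (\<exists>n. (x, y) \<in> folded p C (H n))"
      proof eventually_elim
        case (elim x)
        have *: "\<exists>n. (p x, y) \<in> H n" if "(p x, y) \<in> E" for y
          using elim that by (cases "x \<in> A'") (auto simp: p_def)
        show ?case
        proof (intro allI impI)
          fix y assume xy: "(x, y) \<in> ?F"
          then have "(p x, p y) \<in> E" by (simp add: folded_def)
          from *[OF this] obtain n where "(p x, p y) \<in> H n" ..
          then have "(x, y) \<in> folded p C (H n)" using xy by (simp add: folded_def)
          then show "\<exists>n. (x, y) \<in> folded p C (H n)" ..
        qed
      qed
    qed
  qed
  let ?B = "?F \<inter> S"
  have bB: "borel_equiv M ?B" by (rule borel_equiv_Int[OF bF bS])
  have sB: "subequiv M R ?B" using bB SR by (auto simp: subequiv_def)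
  have "AE x in M. \<forall>y. (x, y) \<in> ?B \<longrightarrow> (x, y) \<in> S" by simp
  then have BS: "ae_subset M ?B S" unfolding ae_subset_iff[OF borel_equivD(1)[OF bB] borel_equivD(1)[OF bS]] .
  have hB: "hyperfinite M ?B" by (rule hyperfinite_ae_subset[OF bS S(2) bB BS])
  have apB: "aperiodic M ?B"
  proof -
    have rA: "AE x in M. x \<in> A \<longrightarrow> infinite (E `` {x} \<inter> A)"
      by (rule recurrence[OF E(1) ER E(2,3) A(1)])
    have rC: "AE x in M. x \<in> space M - C \<longrightarrow> infinite (E `` {x} \<inter> (space M - C))"
      using C_sets by (intro recurrence[OF E(1) ER E(2,3)]) auto
    have "AE x in M. \<psi> x \<in> A \<longrightarrow> infinite (E `` {\<psi> x} \<inter> A)"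
      unfolding \<psi>_def by (rule full_group_AE_inv[OF \<phi> rA])
    with rA rC AE_space show ?thesis
      unfolding aperiodic_def
    proof eventually_elim
      case (elim x)
      note x = elim(3)
      have Esp: "y \<in> space M" if "(z, y) \<in> E" for y z using borel_equivD(6)[OF E(1) that] by simp
      consider "x \<in> A" | "x \<in> A'" | "x \<notin> C" by (auto simp: C_def)
      then show ?case
      proof cases
        case 1
        have "E `` {x} \<inter> A \<subseteq> ?B `` {x}"
        proof
          fix y assume y: "y \<in> E `` {x} \<inter> A"
          have "p x = x" "p y = y" using 1 y disj by (auto simp: p_def)
          then show "y \<in> ?B `` {x}" using 1 x y Esp ES by (auto simp: folded_def C_def)
        qed
        then show ?thesis using elim(1) 1 finite_subset by blast
      next
        case 2
        have "\<phi> ` (E `` {\<psi> x} \<inter> A) \<subseteq> ?B `` {x}"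
        proof (rule image_subsetI)
          fix z assume "z \<in> E `` {\<psi> x} \<inter> A"
          then have z: "(\<psi> x, z) \<in> E" "z \<in> A" by auto
          have "(\<phi> (\<psi> x), \<phi> z) \<in> S" using z(1) by (simp add: E_def)
          then have "(x, \<phi> z) \<in> S" using \<phi>\<psi>[OF x] by simp
          moreover have "p x = \<psi> x" "p (\<phi> z) = z"
            using 2 \<phi>A'[OF z(2)] \<psi>\<phi> z(2) Asp by (auto simp: p_def)
          ultimately show "\<phi> z \<in> ?B `` {x}"
            using 2 x z \<phi>A'[OF z(2)] \<phi>s Asp by (auto simp: folded_def C_def)
        qed
        moreover have "inj_on \<phi> (E `` {\<psi> x} \<inter> A)"
          using full_groupD(1)[OF \<phi>] Asp by (meson bij_betw_def inf.coboundedI2 inj_on_subset)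
        moreover have "infinite (E `` {\<psi> x} \<inter> A)" using elim(4) 2 by (simp add: A'_iff)
        ultimately show ?thesis using finite_subset finite_imageD by metis
      next
        case 3
        have "E `` {x} \<inter> (space M - C) \<subseteq> ?B `` {x}"
        proof
          fix y assume y: "y \<in> E `` {x} \<inter> (space M - C)"
          have "p x = x" "p y = y" using 3 y by (auto simp: p_def C_def)
          then show "y \<in> ?B `` {x}" using 3 x y ES by (auto simp: folded_def)
        qed
        then show ?thesis using elim(2) 3 x finite_subset by blast
      qed
    qed
  qed
  have Tm_sets: "Tm \<in> sets (M \<Otimes>\<^sub>M M)" using Tm subequivD(3) unfolding maximal_hyperfinite_def by blast
  have "AE x in M. \<forall>y. (x, y) \<in> S \<longrightarrow> (x, y) \<in> Tm"
    using S(3) unfolding ae_subset_iff[OF borel_equivD(1)[OF bS] Tm_sets] .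
  then have "AE x in M. \<forall>y. (x, y) \<in> ?B \<longrightarrow> (x, y) \<in> Tm" by eventually_elim blast
  then have BT: "ae_subset M ?B Tm" unfolding ae_subset_iff[OF borel_equivD(1)[OF bB] Tm_sets] .
  have "ae_subset M ?F Tm"
    by (rule rank_one_absorb[OF r1 Tm sB apB hB BT sF hF]) blast
  then have "AE x in M. \<forall>y. (x, y) \<in> ?F \<longrightarrow> (x, y) \<in> Tm"
    unfolding ae_subset_iff[OF borel_equivD(1)[OF bF] Tm_sets] .
  then show ?thesis
  proof eventually_elim
    case (elim x)
    show ?case
    proof
      assume x: "x \<in> A"
      then have xs: "x \<in> space M" using Asp by blast
      have "p x = x" "p (\<phi> x) = x" using x disj \<phi>A'[OF x] \<psi>\<phi>[OF xs] by (auto simp: p_def)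
      then have "(x, \<phi> x) \<in> ?F"
        using x xs \<phi>s[OF xs] \<phi>A'[OF x] borel_equivD(5)[OF E(1) xs] by (simp add: folded_def C_def)
      then show "(x, \<phi> x) \<in> Tm" using elim by blast
    qed
  qed
qed

text \<open>Countably many displaced sets cover the points that \<open>\<phi>\<close> moves.\<close>

lemma quasi_normalizing_graph_ae_subset:
  assumes r1: "rank_one M R" and Tm: "maximal_hyperfinite M R Tm"
    and S: "subequiv M R S" "hyperfinite M S" "ae_subset M S Tm"
    and \<phi>: "\<phi> \<in> carrier (borel_full_group M R)" and ap: "aperiodic M (push_rel \<phi> S \<inter> S)"
  shows "AE x in M. (x, \<phi> x) \<in> Tm"
proof -
  obtain U where sepU: "separating U" by (rule ex_separating)
  define A where "A i j = U i \<inter> (\<phi> -` U j \<inter> space M)" for i j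
  have bT: "borel_equiv M Tm" using Tm subequivD(1) unfolding maximal_hyperfinite_def by blast
  have "AE x in M. U i \<inter> U j = {} \<longrightarrow> x \<in> A i j \<longrightarrow> (x, \<phi> x) \<in> Tm" for i j
  proof (cases "U i \<inter> U j = {}")
    case True
    have "A i j \<in> sets M"
      unfolding A_def using separatingD(1)[OF sepU] measurable_sets[OF full_groupD(3)[OF \<phi>] separatingD(1)[OF sepU]]
      by (rule sets.Int)
    moreover have "\<phi> x \<notin> A i j" if "x \<in> A i j" for x using that True by (auto simp: A_def)
    ultimately show ?thesis
      using quasi_normalizing_on_displaced_set[OF r1 Tm S \<phi> ap, of "A i j"] by simp
  qed simp
  then have "AE x in M. \<forall>i j. U i \<inter> U j = {} \<longrightarrow> x \<in> A i j \<longrightarrow> (x, \<phi> x) \<in> Tm"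
    by (simp add: AE_all_countable)
  with AE_space show ?thesis
  proof eventually_elim
    case (elim x)
    show ?case
    proof (cases "\<phi> x = x")
      case True
      then show ?thesis using borel_equivD(5)[OF bT elim(1)] by simp
    next
      case False
      then obtain i j where "x \<in> U i" "\<phi> x \<in> U j" "U i \<inter> U j = {}"
        using separatingD(3)[OF sepU elim(1) full_groupD(6)[OF \<phi> elim(1)], of "{}"] by auto
      then show ?thesis using elim by (auto simp: A_def)
    qed
  qed
qed

section \<open>The full group and the quasi-normalizer\<close>

lemma full_group_compose:
  assumes "\<phi> \<in> carrier (borel_full_group M R)" "\<psi> \<in> carrier (borel_full_group M R)"
  shows "compose (space M) \<phi> \<psi> \<in> carrier (borel_full_group M R)" (is "?c \<in> _")
proof -
  let ?S = "space M"
  note \<phi> = full_groupD[OF assms(1)] and \<psi> = full_groupD[OF assms(2)]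
  have Bij: "\<phi> \<in> Bij ?S" "\<psi> \<in> Bij ?S" using assms by (auto simp: borel_full_group_def)
  have c: "?c \<in> Bij ?S" using Bij by (rule compose_Bij)
  have "?c \<in> measurable M M"
    using measurable_compose[OF \<psi>(3) \<phi>(3)]
      measurable_cong[of M ?c "\<lambda>x. \<phi> (\<psi> x)" M] by (simp add: compose_def)
  moreover have "inv_into ?S ?c x = inv_into ?S \<psi> (inv_into ?S \<phi> x)" if x: "x \<in> ?S" for x
  proof (rule inv_into_f_eq)
    show "inj_on ?c ?S" using c by (simp add: Bij_def bij_betw_def)
    have 1: "inv_into ?S \<phi> x \<in> ?S" using Bij(1) x by (rule Bij_inv_into_mem)
    show 2: "inv_into ?S \<psi> (inv_into ?S \<phi> x) \<in> ?S" using Bij(2) 1 by (rule Bij_inv_into_mem)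
    show "?c (inv_into ?S \<psi> (inv_into ?S \<phi> x)) = x"
      using 2 bij_betw_inv_into_right[OF \<psi>(1) 1] bij_betw_inv_into_right[OF \<phi>(1) x]
      by (simp add: compose_def)
  qed
  then have "inv_into ?S ?c \<in> measurable M M"
    using measurable_compose[OF \<phi>(4) \<psi>(4)]
      measurable_cong[of M "inv_into ?S ?c" "\<lambda>x. inv_into ?S \<psi> (inv_into ?S \<phi> x)" M] by simp
  moreover have "(x, ?c x) \<in> R" if x: "x \<in> ?S" for x
    using borel_equivD(8)[OF R \<psi>(5)[OF x] \<phi>(5)[OF \<psi>(6)[OF x]]] x by (simp add: compose_def)
  ultimately show ?thesis using c by (simp add: borel_full_group_def)
qed

lemma full_group_subgroup: "subgroup (carrier (borel_full_group M R)) (BijGroup (space M))"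
proof (rule group.subgroupI[OF group_BijGroup])
  have sub: "\<phi> \<in> Bij (space M)" if "\<phi> \<in> carrier (borel_full_group M R)" for \<phi>
    using that by (simp add: borel_full_group_def)
  then show "carrier (borel_full_group M R) \<subseteq> carrier (BijGroup (space M))"
    by (auto simp: BijGroup_def)
  have "inv_into (space M) (\<lambda>x\<in>space M. x) x = x" if "x \<in> space M" for x
    using that by (intro inv_into_f_eq) (auto simp: inj_on_def)
  then have "inv_into (space M) (\<lambda>x\<in>space M. x) \<in> measurable M M"
    using measurable_cong[of M "inv_into (space M) (\<lambda>x\<in>space M. x)" "\<lambda>x. x" M] by simp
  moreover have "(\<lambda>x\<in>space M. x) \<in> measurable M M"
    using measurable_cong[of M "\<lambda>x\<in>space M. x" "\<lambda>x. x" M] by simp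
  ultimately have "(\<lambda>x\<in>space M. x) \<in> carrier (borel_full_group M R)"
    using id_Bij[of "space M"] borel_equivD(5)[OF R] by (simp add: borel_full_group_def)
  then show "carrier (borel_full_group M R) \<noteq> {}" by blast
  show "inv\<^bsub>BijGroup (space M)\<^esub> \<phi> \<in> carrier (borel_full_group M R)"
    if "\<phi> \<in> carrier (borel_full_group M R)" for \<phi>
    using full_group_inverse[OF that] inv_BijGroup[OF sub[OF that]] by simp
  show "\<phi> \<otimes>\<^bsub>BijGroup (space M)\<^esub> \<psi> \<in> carrier (borel_full_group M R)"
    if "\<phi> \<in> carrier (borel_full_group M R)" "\<psi> \<in> carrier (borel_full_group M R)" for \<phi> \<psi>
    using full_group_compose[OF that] sub that by (simp add: BijGroup_def)
qed

lemma full_group_eq: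
  "borel_full_group M R = (BijGroup (space M))\<lparr>carrier := carrier (borel_full_group M R)\<rparr>"
  by (simp add: borel_full_group_def)

lemma group_full_group: "group (borel_full_group M R)"
  by (subst full_group_eq) (rule subgroup.subgroup_is_group[OF full_group_subgroup group_BijGroup])

lemma full_group_mult:
  assumes "\<phi> \<in> carrier (borel_full_group M R)" "\<psi> \<in> carrier (borel_full_group M R)"
  shows "\<phi> \<otimes>\<^bsub>borel_full_group M R\<^esub> \<psi> = compose (space M) \<phi> \<psi>"
  using assms by (simp add: borel_full_group_def BijGroup_def)

lemma full_group_inv:
  assumes "\<phi> \<in> carrier (borel_full_group M R)"
  shows "inv\<^bsub>borel_full_group M R\<^esub> \<phi> = restrict (inv_into (space M) \<phi>) (space M)"
proof -
  have "inv\<^bsub>borel_full_group M R\<^esub> \<phi> = inv\<^bsub>BijGroup (space M)\<^esub> \<phi>"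
    by (subst full_group_eq) (rule group.m_inv_consistent[OF group_BijGroup full_group_subgroup assms])
  also have "\<dots> = restrict (inv_into (space M) \<phi>) (space M)"
    using assms by (subst inv_BijGroup) (simp_all add: borel_full_group_def)
  finally show ?thesis .
qed

text \<open>For a subequivalence relation \<open>E\<close> this consists of the representatives of the elements of the full
  group whose graph lies in \<open>E\<close> up to null sets.\<close>

definition graphs_in :: "('a \<times> 'a) set \<Rightarrow> ('a \<Rightarrow> 'a) set" where
  "graphs_in E = {\<phi> \<in> carrier (borel_full_group M R). AE x in M. (x, \<phi> x) \<in> E}"

lemma graphs_in_subgroup:
  assumes E: "borel_equiv M E"
  shows "subgroup (graphs_in E) (borel_full_group M R)"
proof (rule group.subgroupI[OF group_full_group])
  interpret G: group "borel_full_group M R" by (rule group_full_group)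
  show "graphs_in E \<subseteq> carrier (borel_full_group M R)" by (auto simp: graphs_in_def)
  have one: "\<one>\<^bsub>borel_full_group M R\<^esub> = (\<lambda>x\<in>space M. x)"
    by (simp add: borel_full_group_def BijGroup_def)
  have "AE x in M. (x, (\<lambda>x\<in>space M. x) x) \<in> E"
    using AE_space by eventually_elim (simp add: borel_equivD(5)[OF E])
  then have "\<one>\<^bsub>borel_full_group M R\<^esub> \<in> graphs_in E"
    using G.one_closed unfolding graphs_in_def one by simp
  then show "graphs_in E \<noteq> {}" by blast
next
  fix \<phi> assume "\<phi> \<in> graphs_in E"
  then have \<phi>: "\<phi> \<in> carrier (borel_full_group M R)" and AE: "AE x in M. (x, \<phi> x) \<in> E"
    by (auto simp: graphs_in_def)
  let ?\<psi> = "inv_into (space M) \<phi>"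
  have "AE x in M. (?\<psi> x, \<phi> (?\<psi> x)) \<in> E" by (rule full_group_AE_inv[OF \<phi> AE])
  with AE_space have "AE x in M. (x, restrict ?\<psi> (space M) x) \<in> E"
  proof eventually_elim
    case (elim x)
    then have "(?\<psi> x, x) \<in> E" using bij_betw_inv_into_right[OF full_groupD(1)[OF \<phi>] elim(1)] by simp
    then show ?case using elim(1) borel_equivD(7)[OF E] by simp
  qed
  then show "inv\<^bsub>borel_full_group M R\<^esub> \<phi> \<in> graphs_in E"
    using full_group_inverse[OF \<phi>] unfolding graphs_in_def full_group_inv[OF \<phi>] by simp
next
  fix \<phi> \<psi> assume "\<phi> \<in> graphs_in E" "\<psi> \<in> graphs_in E"
  then have c: "\<phi> \<in> carrier (borel_full_group M R)" "\<psi> \<in> carrier (borel_full_group M R)"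
    and \<phi>: "AE x in M. (x, \<phi> x) \<in> E" and \<psi>: "AE x in M. (x, \<psi> x) \<in> E"
    by (auto simp: graphs_in_def)
  have "AE x in M. (\<psi> x, \<phi> (\<psi> x)) \<in> E" by (rule full_group_AE[OF c(2) \<phi>])
  with \<psi> AE_space have "AE x in M. (x, compose (space M) \<phi> \<psi> x) \<in> E"
  proof eventually_elim
    case (elim x)
    have "(x, \<phi> (\<psi> x)) \<in> E" by (rule borel_equivD(8)[OF E elim(1) elim(3)])
    then show ?case using elim(2) by (simp add: compose_def)
  qed
  then show "\<phi> \<otimes>\<^bsub>borel_full_group M R\<^esub> \<psi> \<in> graphs_in E"
    using full_group_compose[OF c] unfolding graphs_in_def full_group_mult[OF c] by simp
qed

text \<open>Being the identity almost everywhere means having the graph almost everywhere in the diagonal, so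
  the subgroup property is an instance of the previous lemma.\<close>

lemma null_maps_normal:
  "{\<phi> \<in> carrier (borel_full_group M R). AE x in M. \<phi> x = x} \<lhd> borel_full_group M R" (is "?N \<lhd> ?G")
proof -
  interpret G: group ?G by (rule group_full_group)
  let ?I = "Id_on (space M)"
  have I: "borel_equiv M ?I"
  proof (rule borel_equivI)
    have "space M \<times> space M - {(x, y). x \<in> space M \<and> y \<in> space M \<and> x \<noteq> y} \<in> sets (M \<Otimes>\<^sub>M M)"
      using off_diagonal_sets by auto
    also have "space M \<times> space M - {(x, y). x \<in> space M \<and> y \<in> space M \<and> x \<noteq> y} = ?I" by auto
    finally show "?I \<in> sets (M \<Otimes>\<^sub>M M)" .
  qed auto
  have N: "?N = graphs_in ?I"
  proof -
    have "(AE x in M. \<phi> x = x) \<longleftrightarrow> (AE x in M. (x, \<phi> x) \<in> ?I)" for \<phi>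
      by (rule AE_cong) (auto simp: Id_on_iff)
    then show ?thesis unfolding graphs_in_def by simp
  qed
  have "subgroup ?N ?G" unfolding N by (rule graphs_in_subgroup[OF I])
  moreover have "\<phi> \<otimes>\<^bsub>?G\<^esub> \<nu> \<otimes>\<^bsub>?G\<^esub> inv\<^bsub>?G\<^esub> \<phi> \<in> ?N" if \<phi>: "\<phi> \<in> carrier ?G" and \<nu>: "\<nu> \<in> ?N" for \<phi> \<nu>
  proof -
    let ?\<psi> = "inv_into (space M) \<phi>"
    have \<nu>c: "\<nu> \<in> carrier ?G" and AE: "AE x in M. \<nu> x = x" using \<nu> by auto
    have "AE x in M. \<nu> (?\<psi> x) = ?\<psi> x" by (rule full_group_AE_inv[OF \<phi> AE])
    with AE_space have "AE x in M. (\<phi> \<otimes>\<^bsub>?G\<^esub> \<nu> \<otimes>\<^bsub>?G\<^esub> inv\<^bsub>?G\<^esub> \<phi>) x = x"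
    proof eventually_elim
      case (elim x)
      have c: "\<phi> \<otimes>\<^bsub>?G\<^esub> \<nu> \<in> carrier ?G" using \<phi> \<nu>c by (rule G.m_closed)
      have \<psi>c: "restrict ?\<psi> (space M) \<in> carrier ?G" by (rule full_group_inverse[OF \<phi>])
      have \<psi>s: "?\<psi> x \<in> space M" using full_groupD(6)[OF \<psi>c elim(1)] elim(1) by simp
      have "(\<phi> \<otimes>\<^bsub>?G\<^esub> \<nu> \<otimes>\<^bsub>?G\<^esub> inv\<^bsub>?G\<^esub> \<phi>) x = \<phi> (\<nu> (?\<psi> x))"
        unfolding full_group_inv[OF \<phi>] full_group_mult[OF c \<psi>c] unfolding full_group_mult[OF \<phi> \<nu>c]
        using elim(1) \<psi>s by (simp add: compose_def)
      also have "\<dots> = x"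
        using elim(2) bij_betw_inv_into_right[OF full_groupD(1)[OF \<phi>] elim(1)] by simp
      finally show ?case .
    qed
    then show ?thesis using \<phi> \<nu>c by simp
  qed
  ultimately show ?thesis unfolding G.normal_inv_iff by blast
qed

text \<open>The subgroup \<open>graphs_in E\<close> contains all maps that are almost everywhere the identity, so it is a union
  of elements of the full group. An element that meets it is therefore contained in it, and the set of
  such elements is a subgroup.\<close>

lemma generate_graphs_in:
  assumes E: "borel_equiv M E"
    and gen: "\<And>c. c \<in> Q \<Longrightarrow> c \<in> carrier (full_group M R) \<and> c \<inter> graphs_in E \<noteq> {}"
    and c: "c \<in> generate (full_group M R) Q"
  shows "c \<subseteq> graphs_in E"
proof -
  let ?G = "borel_full_group M R"
  define N where "N = {\<phi> \<in> carrier ?G. AE x in M. \<phi> x = x}"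
  have full_group_Mod: "full_group M R = ?G Mod N" unfolding full_group_def N_def ..
  interpret N: normal N ?G unfolding N_def by (rule null_maps_normal)
  interpret H: subgroup "graphs_in E" ?G by (rule graphs_in_subgroup[OF E])
  have N_sub: "N \<subseteq> graphs_in E"
  proof
    fix \<nu> assume "\<nu> \<in> N"
    then have \<nu>: "\<nu> \<in> carrier ?G" "AE x in M. \<nu> x = x" unfolding N_def by blast+
    from \<nu>(2) AE_space have "AE x in M. (x, \<nu> x) \<in> E"
      by eventually_elim (simp add: borel_equivD(5)[OF E])
    then show "\<nu> \<in> graphs_in E" unfolding graphs_in_def using \<nu>(1) by blast
  qed
  have Q: "c \<subseteq> graphs_in E" if "c \<in> Q" for c
  proof -
    have "c \<in> (\<lambda>a. N #>\<^bsub>?G\<^esub> a) ` carrier ?G"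
      using gen[OF that] unfolding full_group_Mod carrier_FactGroup by blast
    then obtain a where a: "c = N #>\<^bsub>?G\<^esub> a" "a \<in> carrier ?G" by (rule imageE)
    have "\<exists>\<nu>\<in>N. \<nu> \<otimes>\<^bsub>?G\<^esub> a \<in> graphs_in E"
      using gen[OF that] unfolding a(1) r_coset_def by auto
    then obtain \<nu> where \<nu>: "\<nu> \<in> N" "\<nu> \<otimes>\<^bsub>?G\<^esub> a \<in> graphs_in E" by (rule bexE)
    have \<nu>E: "\<nu> \<in> graphs_in E" and \<nu>G: "\<nu> \<in> carrier ?G"
      using \<nu>(1) N_sub N.subset by blast+
    have "inv\<^bsub>?G\<^esub> \<nu> \<otimes>\<^bsub>?G\<^esub> (\<nu> \<otimes>\<^bsub>?G\<^esub> a) \<in> graphs_in E"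
      by (rule H.m_closed[OF H.m_inv_closed[OF \<nu>E] \<nu>(2)])
    also have "inv\<^bsub>?G\<^esub> \<nu> \<otimes>\<^bsub>?G\<^esub> (\<nu> \<otimes>\<^bsub>?G\<^esub> a) = a"
      by (simp only: N.m_assoc[symmetric] N.inv_closed \<nu>G a(2) N.l_inv N.l_one)
    finally have "a \<in> graphs_in E" .
    then show ?thesis unfolding a(1) r_coset_def using N_sub H.m_closed by auto
  qed
  from c show ?thesis
  proof (induction rule: generate.induct)
    case one then show ?case using N_sub by (simp add: full_group_Mod)
  next
    case (incl c) then show ?case by (rule Q)
  next
    case (inv c)
    have "inv\<^bsub>full_group M R\<^esub> c = set_inv\<^bsub>?G\<^esub> c"
      using gen[OF inv] unfolding full_group_Mod by (intro N.inv_FactGroup) simp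
    moreover have "set_inv\<^bsub>?G\<^esub> c \<subseteq> graphs_in E"
      unfolding SET_INV_def using Q[OF inv] by auto
    ultimately show ?case by simp
  next
    case (eng c d)
    have "c \<otimes>\<^bsub>full_group M R\<^esub> d = c <#>\<^bsub>?G\<^esub> d" by (simp add: full_group_Mod)
    moreover have "c <#>\<^bsub>?G\<^esub> d \<subseteq> graphs_in E"
      unfolding set_mult_def using eng.IH by auto
    ultimately show ?case by simp
  qed
qed

lemma quasi_normalizer_graphs_in:
  assumes r1: "rank_one M R" and Tm: "maximal_hyperfinite M R Tm"
    and S: "subequiv M R S" "hyperfinite M S" "ae_subset M S Tm"
    and c: "c \<in> quasi_normalizer M R S"
  shows "c \<subseteq> graphs_in Tm"
  using _ _ c[unfolded quasi_normalizer_def]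
proof (rule generate_graphs_in)
  show "borel_equiv M Tm" using Tm subequivD(1) unfolding maximal_hyperfinite_def by blast
  fix c assume "c \<in> {c \<in> carrier (full_group M R). \<exists>\<phi>\<in>c. aperiodic M (push_rel \<phi> S \<inter> S)}"
  then obtain \<phi> where c: "c \<in> carrier (full_group M R)" and \<phi>: "\<phi> \<in> c" "aperiodic M (push_rel \<phi> S \<inter> S)"
    by blast
  define N where "N = {\<phi> \<in> carrier (borel_full_group M R). AE x in M. \<phi> x = x}"
  interpret N: normal N "borel_full_group M R" unfolding N_def by (rule null_maps_normal)
  have "c \<in> (\<lambda>a. N #>\<^bsub>borel_full_group M R\<^esub> a)
      ` carrier (borel_full_group M R)"
    using c unfolding full_group_def N_def carrier_FactGroup .
  then have "c \<subseteq> carrier (borel_full_group M R)"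
    by (rule imageE) (simp only: N.r_coset_subset_G[OF N.subset])
  then have "\<phi> \<in> carrier (borel_full_group M R)" using \<phi>(1) by blast
  then have "\<phi> \<in> graphs_in Tm"
    using quasi_normalizing_graph_ae_subset[OF r1 Tm S _ \<phi>(2)] by (simp add: graphs_in_def)
  then show "c \<in> carrier (full_group M R) \<and> c \<inter> graphs_in Tm \<noteq> {}" using c \<phi>(1) by blast
qed

section \<open>The generated subequivalence relation\<close>

lemma graph_sets:
  assumes \<phi>: "\<phi> \<in> measurable M M"
  shows "{(x, \<phi> x) | x. x \<in> space M} \<in> sets (M \<Otimes>\<^sub>M M)"
proof -
  let ?D = "space M \<times> space M - {(x, y). x \<in> space M \<and> y \<in> space M \<and> x \<noteq> y}"
  have "?D \<in> sets (M \<Otimes>\<^sub>M M)" using off_diagonal_sets by auto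
  then have "(\<lambda>z. (\<phi> (fst z), snd z)) -` ?D \<inter> space (M \<Otimes>\<^sub>M M) \<in> sets (M \<Otimes>\<^sub>M M)"
    using \<phi> by (intro measurable_sets[of _ _ "M \<Otimes>\<^sub>M M"]) auto
  also have "(\<lambda>z. (\<phi> (fst z), snd z)) -` ?D \<inter> space (M \<Otimes>\<^sub>M M) = {(x, \<phi> x) | x. x \<in> space M}"
    using measurable_space[OF \<phi>] by (auto simp: space_pair_measure)
  finally show ?thesis .
qed

lemma contains_rel_and_graphs_iff:
  assumes S: "S \<in> sets (M \<Otimes>\<^sub>M M)" and Q: "Q \<in> sets (M \<Otimes>\<^sub>M M)"
    and G: "\<And>c \<phi>. c \<in> G \<Longrightarrow> \<phi> \<in> c \<Longrightarrow> \<phi> \<in> measurable M M"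
  shows "contains_rel_and_graphs M S G Q \<longleftrightarrow>
    (AE x in M. \<forall>y. (x, y) \<in> S \<longrightarrow> (x, y) \<in> Q) \<and> (\<forall>c\<in>G. \<forall>\<phi>\<in>c. AE x in M. (x, \<phi> x) \<in> Q)"
proof -
  have "ae_subset M {(x, \<phi> x) | x. x \<in> space M} Q \<longleftrightarrow> (AE x in M. (x, \<phi> x) \<in> Q)"
    if "c \<in> G" "\<phi> \<in> c" for c \<phi>
    unfolding ae_subset_iff[OF graph_sets[OF G[OF that]] Q] by (rule AE_cong) auto
  then show ?thesis
    unfolding contains_rel_and_graphs_def ae_subset_iff[OF S Q] by simp
qed

text \<open>The admissible relations are closed under countable intersections, but there may be uncountably many
  of them. A smallest one is found by minimization. The relation \<open>E\<close> is exhausted by finite relations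
  \<open>F n\<close>, and the part of an admissible \<open>Q\<close> inside \<open>E\<close> is determined up to null sets by the countably many
  sets of those \<open>x\<close> that have a \<open>Q\<close>-neighbour in \<open>F n\<close> lying in \<open>U i\<close>, because each \<open>y\<close> is isolated in the
  finite set \<open>F n `` {x}\<close> by some \<open>U i\<close>. One countable intersection minimizes the measures of all these
  sets at once. Intersecting it further with any admissible relation cannot decrease them, hence
  changes nothing but a null set.\<close>

lemma ex_generated_subequiv:
  assumes S: "S \<in> sets (M \<Otimes>\<^sub>M M)"
    and G: "\<And>c \<phi>. c \<in> G \<Longrightarrow> \<phi> \<in> c \<Longrightarrow> \<phi> \<in> measurable M M"
    and E: "subequiv M R E" "hyperfinite M E" "contains_rel_and_graphs M S G E"
  shows "\<exists>Q. is_generated_subequiv M R S G Q"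
proof -
  define \<Q> where "\<Q> = {Q. subequiv M R Q \<and> contains_rel_and_graphs M S G Q}"
  have \<Q>_iff: "Q \<in> \<Q> \<longleftrightarrow> subequiv M R Q \<and> (AE x in M. \<forall>y. (x, y) \<in> S \<longrightarrow> (x, y) \<in> Q) \<and>
      (\<forall>c\<in>G. \<forall>\<phi>\<in>c. AE x in M. (x, \<phi> x) \<in> Q)" for Q
  proof (cases "subequiv M R Q")
    case True
    have "contains_rel_and_graphs M S G Q \<longleftrightarrow>
      (AE x in M. \<forall>y. (x, y) \<in> S \<longrightarrow> (x, y) \<in> Q) \<and> (\<forall>c\<in>G. \<forall>\<phi>\<in>c. AE x in M. (x, \<phi> x) \<in> Q)"
      by (rule contains_rel_and_graphs_iff[OF S subequivD(3)[OF True]]) (rule G)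
    with True show ?thesis unfolding \<Q>_def by simp
  qed (simp add: \<Q>_def)
  have E\<Q>: "E \<in> \<Q>" using E by (simp add: \<Q>_def)
  have \<Q>_INT: "(\<Inter>i. Q i) \<in> \<Q>" if Q: "\<And>i::nat. Q i \<in> \<Q>" for Q
  proof -
    have b: "borel_equiv M (Q i)" "Q i \<subseteq> R" for i
      using Q[of i] by (auto simp: \<Q>_def subequiv_def)
    have "borel_equiv M (\<Inter>i. Q i)"
    proof (rule borel_equivI)
      show "(\<Inter>i. Q i) \<in> sets (M \<Otimes>\<^sub>M M)" using borel_equivD(1)[OF b(1)] by auto
    next
      fix x assume "x \<in> space M"
      then show "(x, x) \<in> (\<Inter>i. Q i)" using borel_equivD(5)[OF b(1)] by simp
    next
      fix x y assume "(x, y) \<in> (\<Inter>i. Q i)"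
      then show "(y, x) \<in> (\<Inter>i. Q i)" using borel_equivD(7)[OF b(1)] by simp
    next
      fix x y z assume xyz: "(x, y) \<in> (\<Inter>i. Q i)" "(y, z) \<in> (\<Inter>i. Q i)"
      have "(x, z) \<in> Q i" for i
        by (rule borel_equivD(8)[OF b(1), of x y]) (use xyz in auto)
      then show "(x, z) \<in> (\<Inter>i. Q i)" by simp
    qed
    moreover have "(\<Inter>i. Q i) \<subseteq> R" using b(2)[of 0] by blast
    moreover have "AE x in M. \<forall>y. (x, y) \<in> S \<longrightarrow> (x, y) \<in> (\<Inter>i. Q i)"
    proof -
      have "AE x in M. \<forall>i. \<forall>y. (x, y) \<in> S \<longrightarrow> (x, y) \<in> Q i"
        using Q unfolding \<Q>_iff AE_all_countable by blast
      then show ?thesis by eventually_elim blast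
    qed
    moreover have "AE x in M. (x, \<phi> x) \<in> (\<Inter>i. Q i)" if "c \<in> G" "\<phi> \<in> c" for c \<phi>
    proof -
      have "AE x in M. \<forall>i. (x, \<phi> x) \<in> Q i"
        using Q that unfolding \<Q>_iff AE_all_countable by blast
      then show ?thesis by eventually_elim blast
    qed
    ultimately show ?thesis unfolding \<Q>_iff by (simp add: subequiv_def)
  qed
  have \<Q>_Int: "P \<inter> Q \<in> \<Q>" if "P \<in> \<Q>" "Q \<in> \<Q>" for P Q
  proof -
    have "(\<Inter>i::nat. if i = 0 then P else Q) = P \<inter> Q" by (auto split: if_splits)
    then show ?thesis using \<Q>_INT[of "\<lambda>i. if i = 0 then P else Q"] that by simp
  qed
  have bE: "borel_equiv M E" by (rule subequivD(1)[OF E(1)])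
  obtain F :: "nat \<Rightarrow> ('a \<times> 'a) set" where F: "\<And>n. borel_equiv M (F n)" "\<And>n. F n \<subseteq> E"
    and fin: "\<And>n x. x \<in> space M \<Longrightarrow> finite (F n `` {x})" and inc: "\<And>n. F n \<subseteq> F (Suc n)"
    and AE: "AE x in M. \<forall>y. (x, y) \<in> E \<longrightarrow> (\<exists>n. (x, y) \<in> F n)"
    using bE E(2) by (rule hyperfiniteE) blast
  obtain U where sepU: "separating U" by (rule ex_separating)
  define sec where "sec Q k = (case prod_decode k of (n, i) \<Rightarrow> Domain (Q \<inter> F n \<inter> space M \<times> U i))" for Q k
  have sec_iff: "x \<in> sec Q (prod_encode (n, i)) \<longleftrightarrow> x \<in> space M \<and> (\<exists>y\<in>U i. (x, y) \<in> Q \<inter> F n)" for x Q n i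
    by (auto simp: sec_def)
  have sec_sets: "sec Q k \<in> sets (completion M)" if "Q \<in> \<Q>" for Q k
  proof -
    have "Q \<in> sets (M \<Otimes>\<^sub>M M)" using that subequivD(3) by (auto simp: \<Q>_def)
    then show ?thesis unfolding sec_def
      using borel_equivD(1)[OF F(1)] separatingD(1)[OF sepU]
      by (auto split: prod.split intro!: Domain_completion_sets)
  qed
  have sec_mono: "P \<subseteq> Q \<Longrightarrow> sec P k \<subseteq> sec Q k" for P Q k
    by (auto simp: sec_def split: prod.split)
  let ?m = "\<lambda>k Q. emeasure (completion M) (sec Q k)"
  have "\<exists>P. (\<forall>l::nat. P l \<in> \<Q>) \<and> (INF l. ?m k (P l)) \<le> (INF Q\<in>\<Q>. ?m k Q)" for k
  proof -
    have "?m k ` \<Q> \<noteq> {}" using E\<Q> by blast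
    from ennreal_Inf_countable_INF[OF this] obtain f :: "nat \<Rightarrow> ennreal"
      where f: "range f \<subseteq> ?m k ` \<Q>" "(INF Q\<in>\<Q>. ?m k Q) = (INF l. f l)" by blast
    have "\<forall>l. \<exists>Q. Q \<in> \<Q> \<and> f l = ?m k Q" using f(1) by blast
    then obtain P where P: "\<And>l. P l \<in> \<Q>" "\<And>l. f l = ?m k (P l)" by metis
    then have "(INF l. ?m k (P l)) = (INF Q\<in>\<Q>. ?m k Q)" unfolding f(2) by simp
    then show ?thesis using P(1) by (intro exI[of _ P]) simp
  qed
  then have "\<forall>k. \<exists>P. (\<forall>l::nat. P l \<in> \<Q>) \<and> (INF l. ?m k (P l)) \<le> (INF Q\<in>\<Q>. ?m k Q)" ..
  from choice[OF this] obtain P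
    where P': "\<forall>k. (\<forall>l::nat. P k l \<in> \<Q>) \<and> (INF l. ?m k (P k l)) \<le> (INF Q\<in>\<Q>. ?m k Q)" ..
  have P: "P k l \<in> \<Q>" "(INF l. ?m k (P k l)) \<le> (INF Q\<in>\<Q>. ?m k Q)" for k l
    using P'[rule_format, of k] by (blast, blast)
  define Q where "Q = E \<inter> (\<Inter>k. \<Inter>l. P k l)"
  have "(\<Inter>l. P k l) \<in> \<Q>" for k using \<Q>_INT[of "P k"] P(1) by simp
  then have "(\<Inter>k. \<Inter>l. P k l) \<in> \<Q>" using \<Q>_INT[of "\<lambda>k. \<Inter>l. P k l"] by simp
  then have Q\<Q>: "Q \<in> \<Q>" unfolding Q_def by (rule \<Q>_Int[OF E\<Q>])
  have Q_min: "?m k Q \<le> ?m k Q'" if "Q' \<in> \<Q>" for Q' k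
  proof -
    have "?m k Q \<le> ?m k (P k l)" for l
    proof (rule emeasure_mono[OF sec_mono sec_sets[OF P(1)]])
      show "Q \<subseteq> P k l" unfolding Q_def by blast
    qed
    then have "?m k Q \<le> (INF l. ?m k (P k l))" by (rule INF_greatest)
    also note P(2)
    also have "(INF Q\<in>\<Q>. ?m k Q) \<le> ?m k Q'" using that by (rule INF_lower)
    finally show ?thesis .
  qed
  have "ae_subset M Q Q'" if Q': "Q' \<in> \<Q>" for Q'
  proof -
    have QQ': "Q \<inter> Q' \<in> \<Q>" by (rule \<Q>_Int[OF Q\<Q> Q'])
    have "AE x in M. x \<notin> sec Q k - sec (Q \<inter> Q') k" for k
    proof -
      have sets: "sec Q k \<in> sets (completion M)" "sec (Q \<inter> Q') k \<in> sets (completion M)"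
        by (rule sec_sets[OF Q\<Q>], rule sec_sets[OF QQ'])
      have D: "sec Q k - sec (Q \<inter> Q') k \<in> sets (completion M)" using sets by (rule sets.Diff)
      have "?m k (Q \<inter> Q') \<le> emeasure (completion M) (space (completion M))" by (rule emeasure_space)
      also have "\<dots> = 1" by (simp add: emeasure_space_1)
      finally have fin_m: "?m k (Q \<inter> Q') \<noteq> \<infinity>"
        by (auto simp: top_unique simp del: emeasure_completion)
      have sub: "sec (Q \<inter> Q') k \<subseteq> sec Q k" by (rule sec_mono) blast
      have "?m k Q = ?m k (Q \<inter> Q')"
        using Q_min[OF QQ'] emeasure_mono[OF sub sets(1)] by (rule antisym)
      then have "emeasure (completion M) (sec Q k - sec (Q \<inter> Q') k) = ?m k (Q \<inter> Q') - ?m k (Q \<inter> Q')"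
        using emeasure_Diff[OF fin_m sets(1,2) sub] by (simp only:)
      also have "\<dots> = 0" using fin_m by (intro ennreal_diff_self) simp
      finally show ?thesis unfolding AE_notin_iff_completion[OF D] .
    qed
    then have "AE x in M. \<forall>k. x \<notin> sec Q k - sec (Q \<inter> Q') k" by (simp add: AE_all_countable)
    with AE AE_space have "AE x in M. \<forall>y. (x, y) \<in> Q \<longrightarrow> (x, y) \<in> Q'"
    proof eventually_elim
      case (elim x)
      show ?case
      proof (intro allI impI)
        fix y assume xy: "(x, y) \<in> Q"
        then have "(x, y) \<in> E" by (simp add: Q_def)
        then obtain n where n: "(x, y) \<in> F n" using elim(1) by blast
        have "y \<in> space M" using borel_equivD(6)[OF F(1) n] by simp
        then obtain i where i: "y \<in> U i" "U i \<inter> (F n `` {x} - {y}) = {}"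
          using separatingD(2)[OF sepU, of y "F n `` {x} - {y}"] fin[OF elim(2), of n] by auto
        have "x \<in> sec Q (prod_encode (n, i))" using xy n i(1) elim(2) unfolding sec_iff by blast
        then have "x \<in> sec (Q \<inter> Q') (prod_encode (n, i))" using elim(3) by blast
        then obtain z where z: "z \<in> U i" "(x, z) \<in> Q'" "(x, z) \<in> F n" unfolding sec_iff by blast
        then have "z = y" using i(2) by blast
        then show "(x, y) \<in> Q'" using z(2) by simp
      qed
    qed
    moreover have "Q \<in> sets (M \<Otimes>\<^sub>M M)" "Q' \<in> sets (M \<Otimes>\<^sub>M M)"
      using Q\<Q> Q' subequivD(3) by (auto simp: \<Q>_def)
    ultimately show ?thesis using ae_subset_iff by blast
  qed
  then have "is_generated_subequiv M R S G Q"
    using Q\<Q> unfolding is_generated_subequiv_def \<Q>_def by blast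
  then show ?thesis by blast
qed

end

theorem theorem4p4:
  fixes M :: "'a measure" and R S :: "('a \<times> 'a) set"
  assumes "standard_prob_space M"
    and "discrete_borel_equiv M R"
    and "invariant_measure M R"
    and "ergodic_measure M R"
    and "rank_one M R"
    and "subequiv M R S"
    and "aperiodic M S"
    and "hyperfinite M S"
  shows "(\<exists>Q. is_generated_subequiv M R S (quasi_normalizer M R S) Q) \<and>
    (\<forall>Q. is_generated_subequiv M R S (quasi_normalizer M R S) Q \<longrightarrow> hyperfinite M Q)"
proof -
  obtain T where "prob_space M" "topspace T = space M" "completely_metrizable_space T" "separable_space T"
    "sets M = sigma_sets (space M) {U. openin T U}"
    using assms(1) unfolding standard_prob_space_def standard_borel_def by blast
  moreover have "borel_equiv M R" using assms(2) by (simp add: discrete_borel_equiv_def)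
  ultimately interpret invariant_equiv M T R
    using assms(3)
    by (simp add: invariant_equiv_def invariant_equiv_axioms_def polish_prob_def polish_prob_axioms_def)
  let ?N = "quasi_normalizer M R S"
  obtain E where E: "maximal_hyperfinite M R E" "ae_subset M S E"
    using assms(5-8) unfolding rank_one_def by blast
  then have sE: "subequiv M R E" and hE: "hyperfinite M E" by (auto simp: maximal_hyperfinite_def)
  have N: "c \<subseteq> graphs_in E" if "c \<in> ?N" for c
    by (rule quasi_normalizer_graphs_in[OF assms(5) E(1) assms(6,8) E(2) that])
  have meas: "\<phi> \<in> measurable M M" if "c \<in> ?N" "\<phi> \<in> c" for c \<phi>
    using N[OF that(1)] that(2) full_groupD(3) by (auto simp: graphs_in_def)
  have SE: "AE x in M. \<forall>y. (x, y) \<in> S \<longrightarrow> (x, y) \<in> E"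
    using E(2) unfolding ae_subset_iff[OF subequivD(3)[OF assms(6)] subequivD(3)[OF sE]] .
  have "contains_rel_and_graphs M S ?N E \<longleftrightarrow>
      (AE x in M. \<forall>y. (x, y) \<in> S \<longrightarrow> (x, y) \<in> E) \<and> (\<forall>c\<in>?N. \<forall>\<phi>\<in>c. AE x in M. (x, \<phi> x) \<in> E)"
    by (rule contains_rel_and_graphs_iff[OF subequivD(3)[OF assms(6)] subequivD(3)[OF sE]]) (rule meas)
  moreover have "AE x in M. (x, \<phi> x) \<in> E" if "c \<in> ?N" "\<phi> \<in> c" for c \<phi>
    using N[OF that(1)] that(2) by (auto simp: graphs_in_def)
  ultimately have contains: "contains_rel_and_graphs M S ?N E" using SE by simp
  show ?thesis
  proof (intro conjI allI impI)
    show "\<exists>Q. is_generated_subequiv M R S ?N Q"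
      by (rule ex_generated_subequiv[OF subequivD(3)[OF assms(6)] _ sE hE contains]) (rule meas)
    fix Q assume "is_generated_subequiv M R S ?N Q"
    then have "subequiv M R Q" "ae_subset M Q E"
      using sE contains unfolding is_generated_subequiv_def by auto
    then show "hyperfinite M Q"
      by (intro hyperfinite_ae_subset[OF subequivD(1)[OF sE] hE] subequivD(1))
  qed
qed

end
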